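(* Let $\tau\in\mathbb{C}$ with $\operatorname{Im}\tau>0$ and let $l\ge 1$ be an integer. For odd $2l+1=3,5,7,\dots$ we have $$\theta_1((2l+1)z|\tau)=C\prod_{k=-l}^{l}\prod_{j=-l}^{l}\theta_1\!\left(z+\frac{k\pi}{2l+1}+\frac{j\pi\tau}{2l+1}\,\Big|\,\tau\right)$$ with $$C^{-1}=\frac{1}{2l+1}\prod_{\substack{-l\le k\le l,\ -l\le j\le l\\ |j|+|k|\neq0}}\theta_1\!\left(\frac{k\pi}{2l+1}+\frac{j\pi\tau}{2l+1}\,\Big|\,\tau\right).$$ For even $2l=2,4,6,\dots$ we have $$\theta_1(2lz|\tau)=\tilde C\prod_{m=-(l-1)}^{l}\theta_4\!\left(z+\frac{m\pi}{2l}\,\Big|\,\tau\right)\times\prod_{k=-(l-1)}^{l}\ \prod_{j=-(l-1)}^{l-1}\theta_1\!\left(z+\frac{k\pi}{2l}+\frac{j\pi\tau}{2l}\,\Big|\,\tau\right)$$ with $$\tilde C^{-1}=\frac{1}{2l}\prod_{m=-(l-1)}^{l}\theta_4\!\left(\frac{m\pi}{2l}\,\Big|\,\tau\right)\times\prod_{\substack{-(l-1)\le k\le l,\ -(l-1)\le j\le l-1\\ |j|+|k|\neq0}}\theta_1\!\left(\frac{k\pi}{2l}+\frac{j\pi\tau}{2l}\,\Big|\,\tau\right).$$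
   Context: For $\operatorname{Im}\tau>0$ and $q=e^{i\pi\tau}$ (with $q^s$ meaning $e^{i\pi\tau s}$), the theta functions are the entire functions of $z$ $$\theta_1(z|\tau)=2\sum_{n=0}^\infty(-1)^nq^{(n+1/2)^2}\sin((2n+1)z),\qquad \theta_4(z|\tau)=1+2\sum_{n=1}^\infty(-1)^nq^{n^2}\cos(2nz).$$ *)

theory Defs
  imports "HOL-Analysis.Analysis"
begin

(* q^s = exp(i pi tau s): this fixes the branch of the non-integral powers of the nome. *)
definition nome_powr :: "complex \<Rightarrow> real \<Rightarrow> complex" where
  "nome_powr \<tau> s = exp (\<i> * of_real pi * \<tau> * of_real s)"

(* Both series converge absolutely for every z when Im tau > 0; only that range is meaningful. *)
definition theta1 :: "complex \<Rightarrow> complex \<Rightarrow> complex" where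
  "theta1 z \<tau> =
     2 * (\<Sum>n. (-1) ^ n * nome_powr \<tau> ((real n + 1/2)\<^sup>2) * sin (of_nat (2 * n + 1) * z))"

(* The sum over n >= 1 is written with Suc n. *)
definition theta4 :: "complex \<Rightarrow> complex \<Rightarrow> complex" where
  "theta4 z \<tau> =
     1 + 2 * (\<Sum>n. (-1) ^ Suc n * nome_powr \<tau> ((real (Suc n))\<^sup>2)
                     * cos (of_nat (2 * Suc n) * z))"

end

theory Submission
  imports Defs "HOL-Complex_Analysis.Complex_Analysis"
begin

text \<open>
  An entire function vanishing at 0 with the multipliers \<open>-1\<close> and \<open>- q^(-1) exp (-2iz)\<close> for the
  periods \<open>\<pi>\<close> and \<open>\<pi>\<tau>\<close> is unique up to a constant factor. Indeed the infinite product
  \<open>theta_prod\<close> has the same multipliers and only simple zeros, namely the lattice points, at which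
  the given function vanishes as well; the quotient is entire and doubly periodic, hence constant by
  Liouville. In particular \<open>theta1\<close> is a nonzero multiple of \<open>theta_prod\<close>.

  The product over the \<open>n\<close>-torsion grid, evaluated at \<open>u / n\<close>, is such a function of \<open>u\<close>, so it is a
  multiple of \<open>theta1 u\<close>, and comparing derivatives at 0 determines the constant. For even \<open>n\<close>, the
  grid row on the half period \<open>\<pi>\<tau> / 2\<close> is an exponential times the product of \<open>theta4\<close> factors.
\<close>

subsection \<open>Two-sided theta series\<close>

text \<open>The negative half starts at -1, so that 0 is counted once. Unordered sums over the
  integers admit reindexing by bijections, which turns quasi-periodicity into a shift of the
  index.\<close>

lemma has_sum_int_split:
  fixes g :: "int \<Rightarrow> complex"
  assumes "summable (\<lambda>n. norm (g (int n)))" "summable (\<lambda>n. norm (g (- int (Suc n))))"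
  shows "(g has_sum ((\<Sum>n. g (int n)) + (\<Sum>n. g (- int (Suc n))))) UNIV"
proof -
  have "((\<lambda>n. g (int n)) has_sum (\<Sum>n. g (int n))) UNIV"
    by (rule norm_summable_imp_has_sum[OF assms(1) summable_sums[OF summable_norm_cancel[OF assms(1)]]])
  then have 1: "(g has_sum (\<Sum>n. g (int n))) (range int)"
    by (subst has_sum_reindex) (auto simp: o_def)
  have "((\<lambda>n. g (- int (Suc n))) has_sum (\<Sum>n. g (- int (Suc n)))) UNIV"
    by (rule norm_summable_imp_has_sum[OF assms(2) summable_sums[OF summable_norm_cancel[OF assms(2)]]])
  then have 2: "(g has_sum (\<Sum>n. g (- int (Suc n)))) (range (\<lambda>n. - int (Suc n)))"
    by (subst has_sum_reindex) (auto simp: o_def inj_def)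
  have "range int \<union> range (\<lambda>n. - int (Suc n)) = UNIV"
  proof -
    have "x \<in> range int \<union> range (\<lambda>n. - int (Suc n))" for x
      by (cases x rule: int_cases) auto
    then show ?thesis by blast
  qed
  moreover have "range int \<inter> range (\<lambda>n. - int (Suc n)) = {}"
    by auto
  ultimately show ?thesis
    using has_sum_Un_disjoint[OF 1 2] by simp
qed

text \<open>The sign \<open>(-1)^n\<close> is absorbed as \<open>exp (\<i> * pi * n)\<close>: each
  term is then a single exponential, whose norm and behaviour under shifts can be read off the
  exponent.\<close>

definition theta_term :: "complex \<Rightarrow> int \<Rightarrow> complex \<Rightarrow> complex" where
  "theta_term \<tau> n z = exp (\<i> * (of_real pi * of_int n + of_real pi * \<tau> * (of_int n)\<^sup>2 + 2 * of_int n * z))"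

lemma exp_i_pi_nat: "exp (\<i> * of_real pi * of_nat n) = (-1) ^ n"
proof -
  have "exp (of_nat n * (\<i> * of_real pi)) = (-1) ^ n"
    by (subst exp_of_nat_mult) simp
  then show ?thesis
    by (simp add: mult_ac)
qed

lemma norm_theta_term: 
  "norm (theta_term \<tau> n z) = exp (- (pi * Im \<tau> * (of_int n)\<^sup>2) - 2 * of_int n * Im z)"
proof -
  have "Re (\<i> * (of_real pi * of_int n + of_real pi * \<tau> * (of_int n)\<^sup>2 + 2 * of_int n * z))
      = - (pi * Im \<tau> * (of_int n)\<^sup>2) - 2 * of_int n * Im z"
    by (simp add: power2_eq_square)
  then show ?thesis
    by (simp only: theta_term_def norm_exp_eq_Re)
qed

text \<open>For \<open>y > 0\<close> this is the maximum over real \<open>x\<close> of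
  \<open>(2 * R + 1) * x - pi * y * x^2\<close>.\<close>

definition theta_bound :: "real \<Rightarrow> real \<Rightarrow> real" where
  "theta_bound y R = (2 * R + 1)\<^sup>2 / (4 * pi * y)"

text \<open>The Gaussian decay in \<open>n\<close> beats the linear growth caused by
  \<open>Im z\<close>, with a factor \<open>exp (- \<bar>n\<bar>)\<close> to spare. The resulting
  geometric majorant is uniform on a horizontal strip.\<close>

lemma norm_theta_term_le:
  assumes "Im \<tau> > 0" "\<bar>Im z\<bar> \<le> R"
  shows "norm (theta_term \<tau> n z) \<le> exp (theta_bound (Im \<tau>) R) * exp (- 1) ^ nat \<bar>n\<bar>"
proof -
  define x :: real where "x = of_int \<bar>n\<bar>"
  define c where "c = pi * Im \<tau>"
  have c: "c > 0" using assms by (simp add: c_def)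
  \<comment> \<open>Completing the square; the linear coefficient is \<open>2 * R + 1\<close> rather
    than \<open>2 * R\<close> in order to leave \<open>- x\<close> over for the geometric
    factor.\<close>
  have "4 * c * (c * x\<^sup>2 - (2 * R + 1) * x + (2*R+1)\<^sup>2 / (4 * c)) = (2 * c * x - (2 * R + 1))\<^sup>2"
    using c by (simp add: field_simps power2_eq_square)
  then have "4 * c * (c * x\<^sup>2 - (2 * R + 1) * x + (2*R+1)\<^sup>2 / (4 * c)) \<ge> 0"
    by simp
  then have *: "c * x\<^sup>2 - (2 * R + 1) * x + (2*R+1)\<^sup>2 / (4 * c) \<ge> 0"
    using c by (simp add: zero_le_mult_iff)
  have "- (of_int n * Im z) \<le> x * R"
  proof -
    have "- (of_int n * Im z) \<le> \<bar>of_int n * Im z\<bar>" by linarith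
    also have "\<dots> = x * \<bar>Im z\<bar>" by (simp add: x_def abs_mult)
    also have "\<dots> \<le> x * R" using assms(2) by (intro mult_left_mono) (auto simp: x_def)
    finally show ?thesis .
  qed
  then have "- (2 * of_int n * Im z) \<le> 2 * R * x"
    by (simp add: algebra_simps)
  moreover have "c * (of_int n)\<^sup>2 = c * x\<^sup>2" by (simp add: x_def)
  moreover have "2 * R * x - c * x\<^sup>2 \<le> theta_bound (Im \<tau>) R - x"
    using * by (simp add: theta_bound_def c_def algebra_simps)
  ultimately have "- (c * (of_int n)\<^sup>2) - 2 * of_int n * Im z \<le> theta_bound (Im \<tau>) R - x"
    by linarith
  moreover have e: "exp (- 1) ^ nat \<bar>n\<bar> = exp (- x)"
    by (simp add: x_def flip: exp_of_nat_mult)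
  ultimately show ?thesis
    unfolding norm_theta_term e c_def exp_add[symmetric] by simp
qed

lemma summable_theta_bound: "summable (\<lambda>n. exp M * exp (- 1 :: real) ^ n)"
  by (intro summable_mult summable_geometric) simp

lemma summable_theta_term:
  assumes "Im \<tau> > 0"
  shows "summable (\<lambda>n. norm (theta_term \<tau> (int n) z))"
    and "summable (\<lambda>n. norm (theta_term \<tau> (- int n) z))"
    and "summable (\<lambda>n. norm (theta_term \<tau> (- int (Suc n)) z))"
proof -
  have bound: "norm (norm (theta_term \<tau> k z)) \<le> exp (theta_bound (Im \<tau>) \<bar>Im z\<bar>) * exp (- 1) ^ n"
    if "\<bar>k\<bar> = int n" for k n
    using norm_theta_term_le[OF assms order_refl, of k] that by simp
  show "summable (\<lambda>n. norm (theta_term \<tau> (int n) z))"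
    by (rule summable_comparison_test'[OF summable_theta_bound, of 0]) (rule bound, simp)
  show *: "summable (\<lambda>n. norm (theta_term \<tau> (- int n) z))"
    by (rule summable_comparison_test'[OF summable_theta_bound, of 0]) (rule bound, simp)
  show "summable (\<lambda>n. norm (theta_term \<tau> (- int (Suc n)) z))"
    using * by (subst summable_Suc_iff[of "\<lambda>n. norm (theta_term \<tau> (- int n) z)"])
qed

lemma theta_term_altdef:
  "theta_term \<tau> n z = (-1) powi n * nome_powr \<tau> ((of_int n)\<^sup>2) * exp (\<i> * (2 * of_int n * z))"
proof -
  have 1: "exp (\<i> * (of_real pi * of_int n)) = (-1) powi n"
  proof -
    have "exp (of_int n * (\<i> * of_real pi)) = (-1) powi n"
      by (metis exp_pi_i exp_power_int mult.commute)
    then show ?thesis by (simp add: mult_ac)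
  qed
  have "\<i> * (of_real pi * of_int n + of_real pi * \<tau> * (of_int n)\<^sup>2 + 2 * of_int n * z)
     = \<i> * (of_real pi * of_int n) + \<i> * of_real pi * \<tau> * of_real ((of_int n)\<^sup>2)
        + \<i> * (2 * of_int n * z)"
    by (simp add: algebra_simps)
  then show ?thesis
    unfolding theta_term_def nome_powr_def by (simp only: exp_add 1)
qed

lemma powi_minus_one_int: "(-1 :: complex) powi (int n) = (-1) ^ n" "(-1 :: complex) powi (- int n) = (-1) ^ n"
  by (simp_all add: power_int_minus power_inverse[symmetric] del: power_inverse)

text \<open>The sign and the power of the nome are even in \<open>n\<close>, so only the two
  exponentials in \<open>z\<close> differ, and they add up to a cosine.\<close>

lemma theta_term_pair:
  "theta_term \<tau> (int n) z + theta_term \<tau> (- int n) z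
    = 2 * ((-1) ^ n * nome_powr \<tau> ((real n)\<^sup>2) * cos (of_nat (2 * n) * z))"
proof -
  have "exp (\<i> * (2 * of_nat n * z)) + exp (- (\<i> * (2 * of_nat n * z))) = 2 * cos (of_nat (2 * n) * z)"
    by (simp add: cos_exp_eq)
  then show ?thesis
    unfolding theta_term_altdef powi_minus_one_int
    by (simp add: algebra_simps flip: distrib_left)
qed

lemma theta4_has_sum:
  assumes "Im \<tau> > 0"
  shows "((\<lambda>n. theta_term \<tau> n z) has_sum theta4 z \<tau>) UNIV"
proof -
  let ?g = "\<lambda>n. theta_term \<tau> n z"
  have s: "summable (\<lambda>n. ?g (int n))" "summable (\<lambda>n. ?g (- int (Suc n)))"
    by (rule summable_norm_cancel, rule summable_theta_term, rule assms)+
  then have s': "summable (\<lambda>n. ?g (int (Suc n)))"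
    by (subst summable_Suc_iff[of "\<lambda>n. ?g (int n)"])
  have "(\<Sum>n. ?g (int n)) + (\<Sum>n. ?g (- int (Suc n)))
      = 1 + ((\<Sum>n. ?g (int (Suc n))) + (\<Sum>n. ?g (- int (Suc n))))"
    using suminf_split_head[OF s(1)] by (simp add: theta_term_def)
  also have "\<dots> = 1 + (\<Sum>n. ?g (int (Suc n)) + ?g (- int (Suc n)))"
    using suminf_add[OF s' s(2)] by simp
  also have "\<dots> = theta4 z \<tau>"
  proof -
    have *: "summable (\<lambda>n. (-1) ^ Suc n * nome_powr \<tau> ((real (Suc n))\<^sup>2) * cos (of_nat (2 * Suc n) * z))"
      using summable_add[OF s' s(2)] unfolding theta_term_pair by (subst (asm) summable_cmult_iff) simp
    show ?thesis
      unfolding theta4_def theta_term_pair by (subst suminf_mult[OF *]) simp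
  qed
  finally show ?thesis
    using has_sum_int_split[OF summable_theta_term(1)[OF assms] summable_theta_term(3)[OF assms], of z] by simp
qed

text \<open>Since \<open>n^2 + n + 1/4 = (n + 1/2)^2\<close>, a shift by half the period
  \<open>\<pi>\<tau>\<close> and an exponential factor move the integral exponents to half-integral
  ones. Facts about \<open>theta4\<close> thereby carry over to \<open>theta1\<close>.\<close>

lemma theta1_eq_theta4:
  assumes "Im \<tau> > 0"
  shows "theta1 z \<tau> = - \<i> * exp (\<i> * of_real pi * \<tau> / 4 + \<i> * z) * theta4 (z + of_real pi * \<tau> / 2) \<tau>"
proof -
  let ?w = "z + of_real pi * \<tau> / 2"
  define c where "c = - \<i> * exp (\<i> * of_real pi * \<tau> / 4 + \<i> * z)"
  let ?g = "\<lambda>n. theta_term \<tau> n ?w"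
  let ?t = "\<lambda>n. (-1) ^ n * nome_powr \<tau> ((real n + 1/2)\<^sup>2) * sin (of_nat (2 * n + 1) * z)"
  have s: "summable (\<lambda>n. ?g (int n))" "summable (\<lambda>n. ?g (- int (Suc n)))"
    by (rule summable_norm_cancel, rule summable_theta_term, rule assms)+
  have "theta4 ?w \<tau> = (\<Sum>n. ?g (int n)) + (\<Sum>n. ?g (- int (Suc n)))"
    by (rule has_sum_unique[OF theta4_has_sum[OF assms]
          has_sum_int_split[OF summable_theta_term(1)[OF assms] summable_theta_term(3)[OF assms]]])
  also have "\<dots> = (\<Sum>n. ?g (int n) + ?g (- int (Suc n)))"
    by (rule suminf_add[OF s])
  finally have "c * theta4 ?w \<tau> = (\<Sum>n. c * (?g (int n) + ?g (- int (Suc n))))"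
    using suminf_mult[OF summable_add[OF s]] by simp
  \<comment> \<open>The indices \<open>n\<close> and \<open>- (n + 1)\<close> lie symmetrically
    about -1/2. After the shift they give opposite frequencies and opposite signs, hence a
    sine.\<close>
  moreover have eq: "c * (?g (int n) + ?g (- int (Suc n))) = 2 * ?t n" for n
  proof -
    let ?N = "nome_powr \<tau> ((real n + 1/2)\<^sup>2)"
    have "exp (\<i> * of_real pi * \<tau> / 4 + \<i> * z) * ?g (int n) = (-1) ^ n * ?N * exp (\<i> * (of_nat (2 * n + 1) * z))"
      unfolding theta_term_def nome_powr_def exp_i_pi_nat[symmetric] exp_add[symmetric]
      by (simp add: algebra_simps power2_eq_square)
    moreover have "exp (\<i> * of_real pi * \<tau> / 4 + \<i> * z) * ?g (- int (Suc n))
        = - ((-1) ^ n * ?N * exp (- (\<i> * (of_nat (2 * n + 1) * z))))"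
    proof -
      have "?g (- int (Suc n)) = - ((-1) ^ n * exp (\<i> * of_real pi * \<tau> * (of_nat (Suc n))\<^sup>2 - \<i> * 2 * of_nat (Suc n) * ?w))"
        unfolding theta_term_altdef powi_minus_one_int nome_powr_def
        by (simp add: algebra_simps mult_exp_exp power2_eq_square)
      moreover have "exp (\<i> * of_real pi * \<tau> / 4 + \<i> * z) * exp (\<i> * of_real pi * \<tau> * (of_nat (Suc n))\<^sup>2 - \<i> * 2 * of_nat (Suc n) * ?w)
         = ?N * exp (- (\<i> * (of_nat (2 * n + 1) * z)))"
        unfolding nome_powr_def exp_add[symmetric]
        by (simp add: algebra_simps power2_eq_square)
      ultimately show ?thesis
        by (simp add: mult.assoc mult.left_commute)
    qed
    ultimately have "exp (\<i> * of_real pi * \<tau> / 4 + \<i> * z) * (?g (int n) + ?g (- int (Suc n)))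
        = (-1) ^ n * ?N * (exp (\<i> * (of_nat (2 * n + 1) * z)) - exp (- (\<i> * (of_nat (2 * n + 1) * z))))"
      by (simp add: distrib_left right_diff_distrib)
    also have "\<dots> = (-1) ^ n * ?N * (2 * \<i> * sin (of_nat (2 * n + 1) * z))"
      by (simp add: sin_exp_eq)
    finally have *: "exp (\<i> * of_real pi * \<tau> / 4 + \<i> * z) * (?g (int n) + ?g (- int (Suc n)))
        = (-1) ^ n * ?N * (2 * \<i> * sin (of_nat (2 * n + 1) * z))" .
    have "c * (?g (int n) + ?g (- int (Suc n))) = - \<i> * ((-1) ^ n * ?N * (2 * \<i> * sin (of_nat (2 * n + 1) * z)))"
      unfolding *[symmetric] by (simp add: c_def mult.assoc)
    also have "\<dots> = 2 * ?t n"
      by (simp add: algebra_simps)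
    finally show ?thesis .
  qed
  moreover have "(\<Sum>n. 2 * ?t n) = 2 * (\<Sum>n. ?t n)"
  proof (rule suminf_mult)
    have "summable (\<lambda>n. 2 * ?t n)"
      using summable_mult[OF summable_add[OF s], of c] unfolding eq .
    then show "summable ?t" by (subst (asm) summable_cmult_iff) simp
  qed
  ultimately show ?thesis
    by (simp add: theta1_def c_def)
qed

section \<open>Quasi-periodicity under the two periods\<close>

lemma theta4_add_pi:
  assumes "Im \<tau> > 0"
  shows "theta4 (z + of_real pi) \<tau> = theta4 z \<tau>"
proof -
  have "theta_term \<tau> n (z + of_real pi) = theta_term \<tau> n z" for n
  proof -
    have "\<i> * (2 * of_int n * (z + of_real pi)) = \<i> * (2 * of_int n * z) + \<i> * (of_int n * (of_real pi * 2))"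
      by (simp add: algebra_simps)
    then show ?thesis
      unfolding theta_term_altdef by (simp only: exp_add exp_2pi_1_int mult_1_right)
  qed
  then show ?thesis
    using has_sum_unique theta4_has_sum[OF assms, of "z + of_real pi"] theta4_has_sum[OF assms, of z]
    by fastforce
qed

text \<open>Because \<open>(n + 1)^2 = n^2 + 2 * n + 1\<close>, the shift of \<open>z\<close>
  amounts to replacing \<open>n\<close> by \<open>n + 1\<close>, up to a factor independent of
  \<open>n\<close>; the sign comes from \<open>(-1)^n\<close>.\<close>

lemma theta4_add_pi_tau:
  assumes "Im \<tau> > 0"
  shows "theta4 (z + of_real pi * \<tau>) \<tau> = - exp (- (\<i> * of_real pi * \<tau>) - 2 * \<i> * z) * theta4 z \<tau>"
proof -
  let ?c = "- exp (- (\<i> * of_real pi * \<tau>) - 2 * \<i> * z)"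
  have "theta_term \<tau> n (z + of_real pi * \<tau>) = ?c * theta_term \<tau> (n + 1) z" for n
  proof -
    have "?c * theta_term \<tau> (n + 1) z
       = exp (\<i> * of_real pi) * exp (- (\<i> * of_real pi * \<tau>) - 2 * \<i> * z) * theta_term \<tau> (n + 1) z"
      by simp
    \<comment> \<open>The prefactor \<open>exp (\<i> * pi)\<close> and the sign of the term at
      \<open>n + 1\<close> contribute \<open>\<i> * pi\<close> each; hence the trailing full period
      of \<open>exp\<close>.\<close>
    also have "\<dots> = exp (\<i> * (of_real pi * of_int n + of_real pi * \<tau> * (of_int n)\<^sup>2 + 2 * of_int n * (z + of_real pi * \<tau>))
        + 2 * of_real pi * \<i>)"
      unfolding theta_term_def exp_add[symmetric]
      by (simp add: algebra_simps power2_eq_square)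
    also have "\<dots> = theta_term \<tau> n (z + of_real pi * \<tau>)"
      unfolding theta_term_def exp_add by simp
    finally show ?thesis by simp
  qed
  moreover have "((\<lambda>n. ?c * theta_term \<tau> (n + 1) z) has_sum ?c * theta4 z \<tau>) UNIV"
  proof (rule has_sum_cmult_right)
    have "bij (\<lambda>n::int. n + 1)"
      by (rule bij_betwI[of _ _ _ "\<lambda>n. n - 1"]) auto
    then show "((\<lambda>n. theta_term \<tau> (n + 1) z) has_sum theta4 z \<tau>) UNIV"
      using theta4_has_sum[OF assms, of z] by (subst has_sum_reindex_bij_betw[of "\<lambda>n. n + 1"])
  qed
  ultimately show ?thesis
    using has_sum_unique theta4_has_sum[OF assms, of "z + of_real pi * \<tau>"] by fastforce
qed

lemma theta1_add_pi:
  assumes "Im \<tau> > 0"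
  shows "theta1 (z + of_real pi) \<tau> = - theta1 z \<tau>"
proof -
  have "exp (\<i> * of_real pi * \<tau> / 4 + \<i> * (z + of_real pi)) = - exp (\<i> * of_real pi * \<tau> / 4 + \<i> * z)"
    by (simp add: exp_add distrib_left)
  moreover have "theta4 (z + of_real pi + of_real pi * \<tau> / 2) \<tau> = theta4 (z + of_real pi * \<tau> / 2) \<tau>"
    using theta4_add_pi[OF assms, of "z + of_real pi * \<tau> / 2"] by (simp add: add_ac)
  ultimately show ?thesis
    unfolding theta1_eq_theta4[OF assms] by simp
qed

lemma theta1_add_pi_tau:
  assumes "Im \<tau> > 0"
  shows "theta1 (z + of_real pi * \<tau>) \<tau> = - exp (- (\<i> * of_real pi * \<tau>) - 2 * \<i> * z) * theta1 z \<tau>"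
proof -
  have "theta4 (z + of_real pi * \<tau> + of_real pi * \<tau> / 2) \<tau>
      = - exp (- (\<i> * of_real pi * \<tau>) - 2 * \<i> * (z + of_real pi * \<tau> / 2)) * theta4 (z + of_real pi * \<tau> / 2) \<tau>"
    using theta4_add_pi_tau[OF assms, of "z + of_real pi * \<tau> / 2"] by (simp add: add_ac)
  moreover have "exp (\<i> * of_real pi * \<tau> / 4 + \<i> * (z + of_real pi * \<tau>))
      * exp (- (\<i> * of_real pi * \<tau>) - 2 * \<i> * (z + of_real pi * \<tau> / 2))
    = exp (- (\<i> * of_real pi * \<tau>) - 2 * \<i> * z) * exp (\<i> * of_real pi * \<tau> / 4 + \<i> * z)"
    unfolding exp_add[symmetric] by (simp add: algebra_simps)
  ultimately show ?thesis
    unfolding theta1_eq_theta4[OF assms] by (simp add: mult_ac)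
qed

section \<open>Holomorphy and non-triviality\<close>

text \<open>Weierstrass M-test with the geometric majorant. Strips serve two purposes: they contain
  closed discs, for holomorphy, and the real axis, for termwise integration.\<close>

lemma theta4_uniform_limit:
  assumes "Im \<tau> > 0"
  shows "uniform_limit {z. \<bar>Im z\<bar> \<le> R}
           (\<lambda>N z. 1 + (\<Sum>n<N. 2 * ((-1) ^ Suc n * nome_powr \<tau> ((real (Suc n))\<^sup>2) * cos (of_nat (2 * Suc n) * z))))
           (\<lambda>z. theta4 z \<tau>) sequentially"
proof -
  let ?u = "\<lambda>n z. 2 * ((-1) ^ Suc n * nome_powr \<tau> ((real (Suc n))\<^sup>2) * cos (of_nat (2 * Suc n) * z))"
  let ?M = "\<lambda>n. 2 * (exp (theta_bound (Im \<tau>) R) * exp (- 1) ^ Suc n)"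
  have bound: "norm (?u n z) \<le> ?M n" if "\<bar>Im z\<bar> \<le> R" for n z
  proof -
    have "norm (theta_term \<tau> (int (Suc n)) z + theta_term \<tau> (- int (Suc n)) z) \<le> ?M n"
      using norm_theta_term_le[OF assms that, of "int (Suc n)"] norm_theta_term_le[OF assms that, of "- int (Suc n)"]
        norm_triangle_ineq[of "theta_term \<tau> (int (Suc n)) z" "theta_term \<tau> (- int (Suc n)) z"]
      by (simp add: nat_add_distrib)
    then show ?thesis
      unfolding theta_term_pair .
  qed
  have sM: "summable ?M"
    using summable_theta_bound by (intro summable_mult) (subst summable_Suc_iff[of "\<lambda>n. exp (- 1 :: real) ^ n"], auto intro: summable_geometric)
  have ul: "uniform_limit {z. \<bar>Im z\<bar> \<le> R} (\<lambda>N z. \<Sum>n<N. ?u n z) (\<lambda>z. \<Sum>n. ?u n z) sequentially"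
    by (rule Weierstrass_m_test[OF bound sM]) simp
  have "uniform_limit {z. \<bar>Im z\<bar> \<le> R} (\<lambda>N z. 1 + (\<Sum>n<N. ?u n z)) (\<lambda>z. 1 + (\<Sum>n. ?u n z)) sequentially"
    by (intro uniform_limit_add uniform_limit_const ul)
  moreover have "1 + (\<Sum>n. ?u n z) = theta4 z \<tau>" if "z \<in> {z. \<bar>Im z\<bar> \<le> R}" for z
  proof -
    have "summable (\<lambda>n. ?u n z)"
      by (rule summable_comparison_test'[OF sM, of 0]) (rule bound, use that in simp)
    then have "summable (\<lambda>n. (-1) ^ Suc n * nome_powr \<tau> ((real (Suc n))\<^sup>2) * cos (of_nat (2 * Suc n) * z))"
      by (subst (asm) summable_cmult_iff) simp
    then show ?thesis
      unfolding theta4_def by (subst suminf_mult) auto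
  qed
  ultimately show ?thesis
    by (subst (asm) uniform_limit_cong'[where g = "\<lambda>N z. 1 + (\<Sum>n<N. ?u n z)" and i = "\<lambda>z. theta4 z \<tau>"]) auto
qed

lemma holomorphic_theta4:
  assumes "Im \<tau> > 0"
  shows "(\<lambda>z. theta4 z \<tau>) holomorphic_on UNIV"
proof (rule holomorphic_uniform_sequence[OF open_UNIV])
  let ?f = "\<lambda>N z. 1 + (\<Sum>n<N. 2 * ((-1) ^ Suc n * nome_powr \<tau> ((real (Suc n))\<^sup>2) * cos (of_nat (2 * Suc n) * z)))"
  show "?f N holomorphic_on UNIV" for N
    by (intro holomorphic_intros)
  show "\<exists>d>0. cball x d \<subseteq> UNIV \<and> uniform_limit (cball x d) ?f (\<lambda>z. theta4 z \<tau>) sequentially" for x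
  proof (intro exI[of _ 1] conjI)
    show "uniform_limit (cball x 1) ?f (\<lambda>z. theta4 z \<tau>) sequentially"
    proof (rule uniform_limit_on_subset[OF theta4_uniform_limit[OF assms, of "\<bar>Im x\<bar> + 1"]], safe)
      fix z assume "z \<in> cball x 1"
      then have "\<bar>Im (x - z)\<bar> \<le> 1"
        using abs_Im_le_cmod[of "x - z"] by (simp add: dist_norm)
      then show "\<bar>Im z\<bar> \<le> \<bar>Im x\<bar> + 1" by simp
    qed
  qed auto
qed

text \<open>This is the constant Fourier coefficient: every cosine integrates to 0 over the
  interval, and uniform convergence allows the passage to the limit. It shows that
  \<open>theta4\<close> is not identically zero without any knowledge of its zeros.\<close>

lemma theta4_integral:
  assumes "Im \<tau> > 0"
  shows "((\<lambda>x. theta4 (of_real x) \<tau>) has_integral of_real pi) {0..pi}"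
proof -
  let ?c = "\<lambda>n. (2 :: complex) * (-1) ^ Suc n * nome_powr \<tau> ((real (Suc n))\<^sup>2)"
  let ?f = "\<lambda>N x. 1 + (\<Sum>n<N. 2 * ((-1) ^ Suc n * nome_powr \<tau> ((real (Suc n))\<^sup>2) * cos (of_nat (2 * Suc n) * of_real x)))"
  have cos: "((\<lambda>x. cos (of_nat (2 * Suc n) * of_real x) :: complex) has_integral 0) {0..pi}" for n
  proof -
    have "((\<lambda>x. cos (of_nat (2 * Suc n) * of_real x) :: complex) has_integral
        sin (of_nat (2 * Suc n) * of_real pi) / of_nat (2 * Suc n) - sin (of_nat (2 * Suc n) * of_real 0) / of_nat (2 * Suc n)) {0..pi}"
      by (intro fundamental_theorem_of_calculus)
         (auto intro!: derivative_eq_intros has_vector_derivative_real_field simp del: of_nat_Suc of_nat_mult)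
    moreover have "sin (of_nat (2 * Suc n) * of_real pi :: complex) = of_real (sin (real (2 * Suc n) * pi))"
      by (simp only: sin_of_real[symmetric] of_real_mult of_real_of_nat_eq)
    ultimately show ?thesis
      by (simp only: sin_npi) simp
  qed
  have "(?f N has_integral (of_real pi + (\<Sum>n<N. ?c n * 0))) {0..pi}" for N
  proof (intro has_integral_add has_integral_sum)
    show "((\<lambda>x. 1 :: complex) has_integral of_real pi) {0..pi}"
      using has_integral_const_real[of "1::complex" 0 pi] by (simp add: scaleR_conv_of_real)
    show "((\<lambda>x. 2 * ((-1) ^ Suc n * nome_powr \<tau> ((real (Suc n))\<^sup>2) * cos (of_nat (2 * Suc n) * of_real x))) has_integral ?c n * 0) {0..pi}" for n
      using has_integral_mult_right[OF cos, of "?c n" n] by (simp only: mult.assoc)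
  qed auto
  then have int: "(?f N has_integral of_real pi) {0..pi}" for N
    by simp
  have "uniform_limit {0..pi} ?f (\<lambda>x. theta4 (of_real x) \<tau>) sequentially"
    by (rule uniform_limit_compose'[OF theta4_uniform_limit[OF assms, of 0]]) auto
  note ul = this
  have cont: "continuous_on {0..pi} (?f N)" for N
    by (intro continuous_on_add continuous_on_sum continuous_on_mult continuous_on_const continuous_on_cos
          continuous_on_of_real continuous_on_id)
  show ?thesis
  proof (rule uniform_limit_integral[OF ul cont sequentially_bot])
    fix I J
    assume I: "\<And>N. (?f N has_integral I N) {0..pi}"
      and J: "((\<lambda>x. theta4 (of_real x) \<tau>) has_integral J) {0..pi}" and lim: "I \<longlonglongrightarrow> J"
    have "I = (\<lambda>_. of_real pi)"
      by (rule ext, rule has_integral_unique[OF I int])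
    then have "J = of_real pi"
      using lim by (simp add: LIMSEQ_const_iff)
    with J show ?thesis by simp
  qed
qed

lemma theta4_not_identically_zero:
  assumes "Im \<tau> > 0"
  obtains z where "theta4 z \<tau> \<noteq> 0"
proof -
  have False if "\<And>z. theta4 z \<tau> = 0"
    using has_integral_unique[OF theta4_integral[OF assms]] that by (simp add: has_integral_is_0)
  then show ?thesis using that by blast
qed

lemma holomorphic_theta1:
  assumes "Im \<tau> > 0"
  shows "(\<lambda>z. theta1 z \<tau>) holomorphic_on UNIV"
  unfolding theta1_eq_theta4[OF assms]
  by (intro holomorphic_intros holomorphic_on_compose_gen[OF _ holomorphic_theta4[OF assms], unfolded o_def]) auto

text \<open>This is what later excludes the constant 0 in the comparison of \<open>theta1\<close>
  with the infinite product.\<close>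

lemma theta1_not_identically_zero:
  assumes "Im \<tau> > 0"
  obtains z where "theta1 z \<tau> \<noteq> 0"
proof -
  obtain z where "theta4 z \<tau> \<noteq> 0"
    using theta4_not_identically_zero[OF assms] .
  then have "theta1 (z - of_real pi * \<tau> / 2) \<tau> \<noteq> 0"
    by (simp add: theta1_eq_theta4[OF assms])
  then show ?thesis using that by blast
qed

subsection \<open>The infinite product\<close>

text \<open>The infinite q-Pochhammer symbol with base \<open>Q\<close> and argument
  \<open>w\<close>.\<close>

definition euler_prod :: "complex \<Rightarrow> complex \<Rightarrow> complex" where
  "euler_prod Q w = (\<Prod>n. 1 - Q ^ n * w)"

lemma convergent_euler_prod:
  fixes Q w :: complex
  assumes "norm Q < 1"
  shows "convergent_prod (\<lambda>n. 1 - Q ^ n * w)"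
proof -
  have "summable (\<lambda>n. norm (Q ^ n * w))"
    using assms by (simp add: norm_mult norm_power summable_mult2 summable_geometric)
  then show ?thesis
    by (intro abs_convergent_prod_imp_convergent_prod summable_imp_abs_convergent_prod) simp
qed

text \<open>Splitting off the factor with index 0. This functional equation is the source of the
  multiplier of \<open>theta_prod\<close> under \<open>\<pi>\<tau>\<close>.\<close>

lemma euler_prod_rec:
  assumes "norm Q < 1"
  shows "euler_prod Q w = (1 - w) * euler_prod Q (Q * w)"
proof -
  have "(\<lambda>n. 1 - Q ^ n * w) has_prod ((\<Prod>k<1. 1 - Q ^ k * w) * (\<Prod>k. 1 - Q ^ (k + 1) * w))"
    by (rule has_prod_ignore_initial_segment'[OF convergent_euler_prod[OF assms]])
  then show ?thesis
    unfolding has_prod_iff euler_prod_def by (simp add: mult_ac)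
qed

lemma euler_prod_eq_0D:
  assumes "norm Q < 1" "euler_prod Q w = 0"
  obtains n where "Q ^ n * w = 1"
  using prodinf_nonzero[OF convergent_euler_prod[OF assms(1), of w]] assms(2)
  unfolding euler_prod_def by auto

text \<open>On a unit disc around \<open>x\<close> the deviations of the factors from 1 have the
  geometric majorant \<open>norm Q ^ n * (norm x + 1)\<close>, so the partial products converge
  uniformly there.\<close>

lemma holomorphic_euler_prod:
  assumes "norm Q < 1"
  shows "euler_prod Q holomorphic_on UNIV"
proof (rule holomorphic_uniform_sequence[OF open_UNIV])
  let ?f = "\<lambda>N w. \<Prod>n<N. 1 - Q ^ n * w"
  show "?f N holomorphic_on UNIV" for N
    by (intro holomorphic_intros)
  show "\<exists>d>0. cball x d \<subseteq> UNIV \<and> uniform_limit (cball x d) ?f (euler_prod Q) sequentially" for x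
  proof (intro exI[of _ 1] conjI)
    let ?M = "\<lambda>n. norm Q ^ n * (norm x + 1)"
    have "summable ?M"
      using assms by (intro summable_mult2 summable_geometric) simp
    moreover have "norm (norm ((1 - Q ^ n * w) - 1)) \<le> ?M n" if "w \<in> cball x 1" for n w
    proof -
      have "norm w \<le> norm x + norm (x - w)"
        by (metis norm_minus_commute norm_triangle_sub)
      then have "norm w \<le> norm x + 1"
        using that by (simp add: dist_norm)
      then show ?thesis
        by (simp add: norm_mult norm_power mult_left_mono)
    qed
    ultimately have "uniform_limit (cball x 1) (\<lambda>N w. \<Sum>n<N. norm ((1 - Q ^ n * w) - 1))
        (\<lambda>w. \<Sum>n. norm ((1 - Q ^ n * w) - 1)) sequentially"
      by (intro Weierstrass_m_test)
    then have "uniformly_convergent_on (cball x 1) (\<lambda>N w. \<Sum>n<N. norm ((1 - Q ^ n * w) - 1))"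
      by (rule uniformly_convergentI)
    then have "uniformly_convergent_on (cball x 1) ?f"
      by (intro Infinite_Products.uniformly_convergent_on_prod') (auto intro!: continuous_intros)
    then have "uniform_limit (cball x 1) ?f (\<lambda>w. lim (\<lambda>N. ?f N w)) sequentially"
      by (simp add: uniformly_convergent_uniform_limit_iff)
    moreover have "lim (\<lambda>N. ?f N w) = euler_prod Q w" for w
      unfolding euler_prod_def
      by (intro limI has_prod_imp_tendsto' convergent_prod_has_prod convergent_euler_prod[OF assms])
    ultimately show "uniform_limit (cball x 1) ?f (euler_prod Q) sequentially"
      by simp
  qed auto
qed

text \<open>Up to a constant this is the triple product for \<open>theta1\<close>, written with the squared nome.\<close>

definition theta_prod :: "complex \<Rightarrow> complex \<Rightarrow> complex" where
  "theta_prod \<tau> z = exp (- \<i> * z) * euler_prod (exp (2 * of_real pi * \<i> * \<tau>)) (exp (2 * \<i> * z))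
     * euler_prod (exp (2 * of_real pi * \<i> * \<tau>)) (exp (2 * of_real pi * \<i> * \<tau>) * exp (- (2 * \<i> * z)))"

lemma norm_square_nome_less_1:
  assumes "Im \<tau> > 0"
  shows "norm (exp (2 * of_real pi * \<i> * \<tau>)) < 1"
  using assms by simp

text \<open>Splitting off the leading factor of the first Euler product isolates the factor that
  vanishes at the origin.\<close>

lemma theta_prod_eq:
  assumes "Im \<tau> > 0"
  defines "Q \<equiv> exp (2 * of_real pi * \<i> * \<tau>)"
  shows "theta_prod \<tau> z = (exp (- \<i> * z) - exp (\<i> * z)) * (euler_prod Q (Q * exp (2 * \<i> * z)) * euler_prod Q (Q * exp (- (2 * \<i> * z))))"
proof -
  have "exp (- \<i> * z) * (1 - exp (2 * \<i> * z)) = exp (- \<i> * z) - exp (\<i> * z)"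
    by (simp add: algebra_simps mult_exp_exp)
  then show ?thesis
    unfolding theta_prod_def Q_def[symmetric]
    by (subst euler_prod_rec[of Q "exp (2 * \<i> * z)"])
       (use norm_square_nome_less_1[OF assms(1)] in \<open>simp_all add: Q_def mult.assoc[symmetric]\<close>)
qed

lemma holomorphic_theta_prod:
  assumes "Im \<tau> > 0"
  shows "theta_prod \<tau> holomorphic_on UNIV"
  unfolding theta_prod_def[abs_def]
  by (intro holomorphic_intros
        holomorphic_on_compose_gen[OF _ holomorphic_euler_prod[OF norm_square_nome_less_1[OF assms]], unfolded o_def]) auto

lemma theta_prod_add_pi: "theta_prod \<tau> (z + of_real pi) = - theta_prod \<tau> z"
proof -
  have "exp (- \<i> * (z + of_real pi)) = - exp (- \<i> * z)"
    by (simp add: distrib_left exp_diff exp_minus field_simps)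
  moreover have pi2: "exp (2 * \<i> * of_real pi) = 1"
    using exp_two_pi_i by (simp add: mult_ac)
  moreover have "exp (2 * \<i> * (z + of_real pi)) = exp (2 * \<i> * z)"
    by (simp add: distrib_left exp_add pi2)
  moreover have "exp (- (2 * \<i> * (z + of_real pi))) = exp (- (2 * \<i> * z))"
    by (simp add: distrib_left exp_add exp_diff exp_minus pi2)
  ultimately show ?thesis
    unfolding theta_prod_def by simp
qed

text \<open>The shift multiplies \<open>w = exp (2 * \<i> * z)\<close> by \<open>Q\<close>: the
  first Euler product loses the factor \<open>1 - w\<close>, the second gains
  \<open>1 - 1 / w\<close>, and formally their ratio is \<open>- 1 / w\<close>.\<close>

lemma theta_prod_add_pi_tau:
  assumes "Im \<tau> > 0"
  shows "theta_prod \<tau> (z + of_real pi * \<tau>) = - exp (- (\<i> * of_real pi * \<tau>) - 2 * \<i> * z) * theta_prod \<tau> z"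
proof -
  define Q where "Q = exp (2 * of_real pi * \<i> * \<tau>)"
  define w where "w = exp (2 * \<i> * z)"
  have Q: "norm Q < 1" "Q \<noteq> 0" and w: "w \<noteq> 0"
    using norm_square_nome_less_1[OF assms] by (simp_all add: Q_def w_def)
  have e: "exp (- (2 * \<i> * z)) = 1 / w"
    by (simp add: w_def exp_minus field_simps)
  have 1: "exp (2 * \<i> * (z + of_real pi * \<tau>)) = Q * w"
    unfolding Q_def w_def exp_add[symmetric] by (simp add: algebra_simps)
  have 2: "exp (- (2 * \<i> * (z + of_real pi * \<tau>))) = 1 / (Q * w)"
    unfolding 1[symmetric] by (simp only: exp_minus inverse_eq_divide)
  have "theta_prod \<tau> (z + of_real pi * \<tau>)
     = exp (- \<i> * (z + of_real pi * \<tau>)) * euler_prod Q (Q * w) * euler_prod Q (1 / w)"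
    using Q w unfolding theta_prod_def Q_def[symmetric] 1 2 by simp
  also have "euler_prod Q (1 / w) = (1 - 1 / w) * euler_prod Q (Q * (1 / w))"
    by (rule euler_prod_rec[OF Q(1)])
  also have "1 - 1 / w = - (1 / w) * (1 - w)"
    using w by (simp add: field_simps)
  also have "exp (- \<i> * (z + of_real pi * \<tau>)) * euler_prod Q (Q * w) * (- (1 / w) * (1 - w) * euler_prod Q (Q * (1 / w)))
    = - (exp (- \<i> * (z + of_real pi * \<tau>)) * (1 / w)) * ((1 - w) * euler_prod Q (Q * w)) * euler_prod Q (Q * (1 / w))"
    by (simp add: mult_ac)
  \<comment> \<open>Using the recurrence backwards avoids a division by \<open>1 - w\<close>, which
    may be 0.\<close>
  also have "(1 - w) * euler_prod Q (Q * w) = euler_prod Q w"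
    by (rule euler_prod_rec[OF Q(1), symmetric])
  also have "exp (- \<i> * (z + of_real pi * \<tau>)) * (1 / w) = exp (- (\<i> * of_real pi * \<tau>) - 2 * \<i> * z) * exp (- \<i> * z)"
    unfolding e[symmetric] exp_add[symmetric] by (rule arg_cong[of _ _ exp]) (simp add: algebra_simps)
  finally show ?thesis
    unfolding theta_prod_def Q_def[symmetric] w_def[symmetric] e by (simp add: mult_ac)
qed

text \<open>A convergent product vanishes only if one of its factors does, and each factor vanishes
  only where an exponential equals 1.\<close>

lemma theta_prod_eq_0D:
  assumes "Im \<tau> > 0" "theta_prod \<tau> z = 0"
  obtains (lattice) m n :: int where "z = of_int m * of_real pi + of_int n * (of_real pi * \<tau>)"
proof -
  define Q where "Q = exp (2 * of_real pi * \<i> * \<tau>)"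
  have Q: "norm Q < 1"
    using norm_square_nome_less_1[OF assms(1)] by (simp add: Q_def)
  have Qpow: "Q ^ n = exp (\<i> * (2 * of_nat n * of_real pi * \<tau>))" for n
    unfolding Q_def exp_of_nat_mult[symmetric] by (simp add: mult_ac)
  \<comment> \<open>Both Euler products lead to this equation: the first with
    \<open>n \<ge> 0\<close>, the second, after taking inverses, with a negative index.\<close>
  have *: thesis if "exp (\<i> * (2 * of_int n * of_real pi * \<tau> + 2 * z)) = 1" for n :: int
  proof -
    from that have "exp (\<i> * (2 * of_int n * of_real pi * \<tau> + 2 * z)) = exp 0" by simp
    then obtain m :: int where "\<i> * (2 * of_int n * of_real pi * \<tau> + 2 * z) = 0 + (of_int (2 * m) * of_real pi) * \<i>"
      unfolding exp_eq by auto
    then have "\<i> * (2 * of_int n * of_real pi * \<tau> + 2 * z) = \<i> * (2 * of_int m * of_real pi)"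
      by (simp add: mult_ac)
    then have eq: "2 * of_int n * of_real pi * \<tau> + 2 * z = 2 * of_int m * of_real pi"
      by (subst (asm) mult_left_cancel) auto
    have "2 * z = (2 * of_int n * of_real pi * \<tau> + 2 * z) - 2 * of_int n * of_real pi * \<tau>"
      by simp
    also have "\<dots> = 2 * (of_int m * of_real pi + of_int (- n) * (of_real pi * \<tau>))"
      unfolding eq by (simp add: algebra_simps)
    finally have "z = of_int m * of_real pi + of_int (- n) * (of_real pi * \<tau>)"
      by (subst (asm) mult_left_cancel) auto
    then show thesis by (rule lattice)
  qed
  from assms(2) consider "euler_prod Q (exp (2 * \<i> * z)) = 0" | "euler_prod Q (Q * exp (- (2 * \<i> * z))) = 0"
    unfolding theta_prod_def Q_def by auto
  then show thesis
  proof cases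
    case 1
    then obtain n where "Q ^ n * exp (2 * \<i> * z) = 1"
      using euler_prod_eq_0D[OF Q] by blast
    then show thesis
      using *[of "int n"] unfolding Qpow exp_add[symmetric] by (simp add: algebra_simps)
  next
    case 2
    then obtain n where "Q ^ n * (Q * exp (- (2 * \<i> * z))) = 1"
      using euler_prod_eq_0D[OF Q] by blast
    then have "Q ^ Suc n * exp (- (2 * \<i> * z)) = 1"
      by (simp add: mult_ac)
    then have "inverse (Q ^ Suc n * exp (- (2 * \<i> * z))) = 1"
      by simp
    then have "exp (- (\<i> * (2 * of_nat (Suc n) * of_real pi * \<tau>)) + 2 * \<i> * z) = 1"
      unfolding Qpow exp_add[symmetric] exp_minus[symmetric] by simp
    then show thesis
      using *[of "- int (Suc n)"] by (simp add: algebra_simps)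
  qed
qed

text \<open>The zero at the origin is simple: near it the product is
  \<open>exp (- \<i> * z) - exp (\<i> * z)\<close> times \<open>N\<close>, and \<open>N 0\<close> is
  the square of \<open>euler_prod Q Q\<close>, which is nonzero because no positive power of
  \<open>Q\<close> equals 1.\<close>

lemma theta_prod_deriv_0:
  assumes "Im \<tau> > 0"
  obtains d where "(theta_prod \<tau> has_field_derivative d) (at 0)" "d \<noteq> 0" "theta_prod \<tau> 0 = 0"
proof -
  define Q where "Q = exp (2 * of_real pi * \<i> * \<tau>)"
  have Q: "norm Q < 1"
    using norm_square_nome_less_1[OF assms(1)] by (simp add: Q_def)
  define N where "N = (\<lambda>z. euler_prod Q (Q * exp (2 * \<i> * z)) * euler_prod Q (Q * exp (- (2 * \<i> * z))))"
  have "N holomorphic_on UNIV"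
    unfolding N_def
    by (intro holomorphic_intros holomorphic_on_compose_gen[OF _ holomorphic_euler_prod[OF Q], unfolded o_def]) auto
  then obtain N' where N': "(N has_field_derivative N') (at 0)"
    by (metis UNIV_I open_UNIV holomorphic_on_open)
  have "euler_prod Q Q \<noteq> 0"
  proof
    assume "euler_prod Q Q = 0"
    then obtain n where "Q ^ n * Q = 1"
      using euler_prod_eq_0D[OF Q] by blast
    then have "norm Q ^ Suc n = 1"
      by (metis norm_one norm_power power_Suc2)
    then show False
      using power_Suc_less_one[of "norm Q" n] Q by (metis less_irrefl norm_ge_zero power_0_Suc le_less zero_neq_one)
  qed
  then have N0: "N 0 \<noteq> 0" by (simp add: N_def)
  have eq: "theta_prod \<tau> = (\<lambda>z. (exp (- \<i> * z) - exp (\<i> * z)) * N z)"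
    using theta_prod_eq[OF assms] by (auto simp: N_def Q_def)
  have "(theta_prod \<tau> has_field_derivative - 2 * \<i> * N 0) (at 0)"
    unfolding eq by (rule derivative_eq_intros N' refl | simp)+
  moreover have "theta_prod \<tau> 0 = 0" by (simp add: eq)
  ultimately show thesis using that N0 by simp
qed

subsection \<open>Uniqueness up to a constant factor\<close>

text \<open>The codomain is arbitrary so that \<open>g\<close> may also be a predicate: the
  vanishing of a function is periodic even when the function itself is only quasi-periodic.\<close>

lemma periodic_lattice:
  fixes g :: "complex \<Rightarrow> 'b"
  assumes "\<And>z. g (z + a) = g z" "\<And>z. g (z + b) = g z"
  shows "g (z + (of_int m * a + of_int n * b)) = g z"
proof -
  have per: "g (z + of_int m * c) = g z" if c: "\<And>z. g (z + c) = g z" for z c and m :: int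
  proof (induction m rule: int_induct[where k = 0])
    case (step1 i)
    then show ?case using c[of "z + of_int i * c"] by (simp add: algebra_simps)
  next
    case (step2 i)
    then show ?case using c[of "z + of_int (i - 1) * c"] by (simp add: algebra_simps)
  qed simp
  show ?thesis
    using per[OF assms(1), of z m] per[OF assms(2), of "z + of_int m * a" n] by (simp add: add.assoc)
qed

text \<open>All values are attained on the compact period parallelogram \<open>S\<close>, so the
  function is bounded.\<close>

lemma doubly_periodic_entire_constant:
  assumes "Im \<tau> > 0" and hol: "h holomorphic_on UNIV"
    and per: "\<And>z. h (z + of_real pi) = h z" "\<And>z. h (z + of_real pi * \<tau>) = h z"
  obtains K where "\<And>z. h z = K"
proof -
  define S where "S = (\<lambda>(s::real, t::real). of_real s * of_real pi + of_real t * (of_real pi * \<tau>)) ` ({0..1} \<times> {0..1})"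
  have "compact S"
    unfolding S_def case_prod_unfold
    by (intro compact_continuous_image compact_Times continuous_intros) auto
  moreover have "continuous_on S h"
    using hol holomorphic_on_imp_continuous_on continuous_on_subset by blast
  ultimately have bS: "bounded (h ` S)"
    by (intro compact_imp_bounded compact_continuous_image)
  have "range h \<subseteq> h ` S"
  proof (intro image_subsetI)
    fix z
    \<comment> \<open>The real coordinates of \<open>z\<close> with respect to the basis
      \<open>\<pi>\<close>, \<open>\<pi>\<tau>\<close>; their fractional parts give the
      representative in \<open>S\<close>.\<close>
    define t where "t = Im z / (pi * Im \<tau>)"
    define s where "s = Re (z - of_real t * (of_real pi * \<tau>)) / pi"
    have z: "z = of_real s * of_real pi + of_real t * (of_real pi * \<tau>)"
      using assms(1) by (auto simp: complex_eq_iff s_def t_def)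
    define z' where "z' = of_real (frac s) * of_real pi + of_real (frac t) * (of_real pi * \<tau>)"
    have "z = z' + (of_int \<lfloor>s\<rfloor> * of_real pi + of_int \<lfloor>t\<rfloor> * (of_real pi * \<tau>))"
      unfolding z z'_def frac_def by (simp add: algebra_simps)
    then have "h z = h z'"
      using periodic_lattice[of h, OF per] by simp
    moreover have "z' \<in> S"
      unfolding S_def z'_def using frac_lt_1 by (intro image_eqI[of _ _ "(frac s, frac t)"]) (auto intro: less_imp_le)
    ultimately show "h z \<in> h ` S" by simp
  qed
  then have "h constant_on UNIV"
    using Liouville_theorem[OF hol] bS bounded_subset by blast
  then show thesis using that unfolding constant_on_def by auto
qed

lemma entire_eq_mult_theta_prod:
  assumes \<tau>: "Im \<tau> > 0" and hol: "f holomorphic_on UNIV" and f0: "f 0 = 0"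
    and f_pi: "\<And>z. f (z + of_real pi) = - f z"
    and f_pi_tau: "\<And>z. f (z + of_real pi * \<tau>) = - exp (- (\<i> * of_real pi * \<tau>) - 2 * \<i> * z) * f z"
  obtains K where "\<And>z. f z = K * theta_prod \<tau> z"
proof -
  let ?P = "theta_prod \<tau>"
  obtain d where d: "(?P has_field_derivative d) (at 0)" "d \<noteq> 0" and P0: "?P 0 = 0"
    using theta_prod_deriv_0[OF \<tau>] .
  obtain f' where f': "(f has_field_derivative f') (at 0)"
    using hol by (metis UNIV_I open_UNIV holomorphic_on_open)
  \<comment> \<open>The zeros of \<open>theta_prod\<close> form the lattice, so one limit at 0 serves all of them.\<close>
  define h where "h z = (if ?P z = 0 then f' / d else f z / ?P z)" for z
  have h_pi: "h (z + of_real pi) = h z" for z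
    by (simp add: h_def theta_prod_add_pi f_pi)
  have h_pi_tau: "h (z + of_real pi * \<tau>) = h z" for z
    by (simp add: h_def theta_prod_add_pi_tau[OF \<tau>] f_pi_tau)
  have contP: "continuous_on UNIV ?P"
    using holomorphic_theta_prod[OF \<tau>] holomorphic_on_imp_continuous_on by blast
  have away: "h analytic_on {z}" if "?P z \<noteq> 0" for z
  proof -
    have o: "open {z. ?P z \<noteq> 0}"
      using contP by (intro open_Collect_neq continuous_on_const)
    have "(\<lambda>z. f z / ?P z) holomorphic_on {z. ?P z \<noteq> 0}"
      by (intro holomorphic_intros holomorphic_on_subset[OF hol] holomorphic_on_subset[OF holomorphic_theta_prod[OF \<tau>]]) auto
    then have "h holomorphic_on {z. ?P z \<noteq> 0}"
      by (rule holomorphic_transform) (auto simp: h_def)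
    then show ?thesis
      using o that unfolding analytic_at by blast
  qed
  have at0: "h analytic_on {0}"
  proof -
    \<comment> \<open>Dividing numerator and denominator by \<open>z\<close> turns the indeterminate
      quotient at 0 into a quotient of derivatives with nonzero denominator
      \<open>d\<close>.\<close>
    have lim: "((\<lambda>z. ?P z / z) \<longlongrightarrow> d) (at 0)" "((\<lambda>z. f z / z) \<longlongrightarrow> f') (at 0)"
      using d(1) f' P0 f0 by (auto simp: has_field_derivative_iff)
    have "eventually (\<lambda>z. ?P z / z \<noteq> 0) (at 0)"
      using tendsto_imp_eventually_ne[OF lim(1) d(2)] .
    then have ev: "eventually (\<lambda>z. ?P z \<noteq> 0 \<and> z \<noteq> 0) (at 0)"
      by eventually_elim auto
    have "((\<lambda>z. (f z / z) / (?P z / z)) \<longlongrightarrow> f' / d) (at 0)"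
      by (intro tendsto_divide lim d)
    then have "(h \<longlongrightarrow> f' / d) (at 0)"
      by (rule Lim_transform_eventually) (use ev in eventually_elim, auto simp: h_def)
    then have limh: "(h \<longlongrightarrow> h 0) (at 0)"
      by (simp add: h_def P0)
    from ev obtain \<epsilon> where \<epsilon>: "\<epsilon> > 0" "\<And>z. z \<in> ball 0 \<epsilon> - {0} \<Longrightarrow> ?P z \<noteq> 0"
      unfolding eventually_at by (auto simp: dist_commute)
    have "h holomorphic_on ball 0 \<epsilon>"
    proof (rule no_isolated_singularity')
      show "(h \<longlongrightarrow> h z) (at z within ball 0 \<epsilon>)" if "z \<in> {0}" for z
        using that limh Lim_at_imp_Lim_at_within by blast
      have "h analytic_on (\<Union>z\<in>ball 0 \<epsilon> - {0}. {z})"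
        unfolding analytic_on_UN using away \<epsilon>(2) by blast
      then show "h holomorphic_on ball 0 \<epsilon> - {0}"
        by (simp add: analytic_imp_holomorphic)
    qed auto
    then show ?thesis
      using \<epsilon>(1) unfolding analytic_at by (intro exI[of _ "ball 0 \<epsilon>"]) auto
  qed
  have "h analytic_on {z}" for z
  proof (cases "?P z = 0")
    case True
    then obtain m n :: int where z: "z = of_int m * of_real pi + of_int n * (of_real pi * \<tau>)"
      using theta_prod_eq_0D[OF \<tau>] by blast
    \<comment> \<open>Translation by a lattice point leaves \<open>h\<close> unchanged, so
      analyticity at 0 is carried over to \<open>z\<close>.\<close>
    have "(\<lambda>w. h (w - z)) = h"
    proof
      fix w
      show "h (w - z) = h w"
        using periodic_lattice[of h, OF h_pi h_pi_tau, of "w - z" m n] by (simp add: z)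
    qed
    moreover have "(h \<circ> (\<lambda>w. w - z)) analytic_on {z}"
      by (rule analytic_on_compose) (use at0 in \<open>auto intro!: analytic_intros\<close>)
    ultimately show ?thesis
      by (simp add: o_def)
  qed (rule away)
  then have "h holomorphic_on UNIV"
    using analytic_imp_holomorphic analytic_on_analytic_at by blast
  then obtain K where K: "\<And>z. h z = K"
    using doubly_periodic_entire_constant[OF \<tau>] h_pi h_pi_tau by metis
  have "f z = K * ?P z" for z
  proof (cases "?P z = 0")
    case True
    then obtain m n :: int where "z = of_int m * of_real pi + of_int n * (of_real pi * \<tau>)"
      using theta_prod_eq_0D[OF \<tau>] by blast
    \<comment> \<open>At a zero of the product the value of \<open>h\<close> says nothing about
      \<open>f\<close>. There \<open>f\<close> vanishes because its multipliers are nonzero and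
      \<open>f 0 = 0\<close>.\<close>
    moreover have "(f (0 + (of_int m * of_real pi + of_int n * (of_real pi * \<tau>))) = 0) = (f 0 = 0)"
      by (rule periodic_lattice) (simp_all add: f_pi f_pi_tau)
    ultimately show ?thesis
      using True f0 by simp
  next
    case False
    then show ?thesis using K[of z] by (simp add: h_def field_simps)
  qed
  then show thesis using that by blast
qed

section \<open>Zeros, derivative at the origin, and uniqueness for \<open>theta1\<close>\<close>

lemma theta1_eq_theta_prod:
  assumes "Im \<tau> > 0"
  obtains K where "K \<noteq> 0" "\<And>z. theta1 z \<tau> = K * theta_prod \<tau> z"
proof -
  have "theta1 0 \<tau> = 0"
    by (simp add: theta1_def)
  then obtain K where K: "\<And>z. theta1 z \<tau> = K * theta_prod \<tau> z"
    using entire_eq_mult_theta_prod[OF assms holomorphic_theta1[OF assms] _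
      theta1_add_pi[OF assms] theta1_add_pi_tau[OF assms]] by blast
  moreover have "K \<noteq> 0"
    using theta1_not_identically_zero[OF assms] K by (metis mult_zero_left)
  ultimately show thesis using that by blast
qed

lemma theta1_eq_0D:
  assumes "Im \<tau> > 0" "theta1 z \<tau> = 0"
  obtains m n :: int where "z = of_int m * of_real pi + of_int n * (of_real pi * \<tau>)"
  using theta1_eq_theta_prod[OF assms(1)] theta_prod_eq_0D[OF assms(1)] assms(2)
  by (metis mult_eq_0_iff)

lemma theta1_deriv_0:
  assumes "Im \<tau> > 0"
  obtains t where "((\<lambda>z. theta1 z \<tau>) has_field_derivative t) (at 0)" "t \<noteq> 0"
proof -
  obtain K where K: "K \<noteq> 0" "\<And>z. theta1 z \<tau> = K * theta_prod \<tau> z"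
    using theta1_eq_theta_prod[OF assms] by blast
  obtain d where d: "(theta_prod \<tau> has_field_derivative d) (at 0)" "d \<noteq> 0"
    using theta_prod_deriv_0[OF assms] .
  have "((\<lambda>z. theta1 z \<tau>) has_field_derivative K * d) (at 0)"
    unfolding K(2) by (rule DERIV_cmult[OF d(1)])
  with K(1) d(2) show thesis using that by simp
qed

lemma entire_eq_mult_theta1:
  assumes \<tau>: "Im \<tau> > 0" and hol: "f holomorphic_on UNIV" and f0: "f 0 = 0"
    and f_pi: "\<And>z. f (z + of_real pi) = - f z"
    and f_pi_tau: "\<And>z. f (z + of_real pi * \<tau>) = - exp (- (\<i> * of_real pi * \<tau>) - 2 * \<i> * z) * f z"
  obtains K where "\<And>z. f z = K * theta1 z \<tau>"
proof -
  obtain K where K: "K \<noteq> 0" "\<And>z. theta1 z \<tau> = K * theta_prod \<tau> z"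
    using theta1_eq_theta_prod[OF \<tau>] by blast
  obtain L where "\<And>z. f z = L * theta_prod \<tau> z"
    using entire_eq_mult_theta_prod[OF assms] by blast
  then have "f z = (L / K) * theta1 z \<tau>" for z
    using K by simp
  then show thesis using that by blast
qed

text \<open>The criterion behind both parities. The hypotheses give
  \<open>u \<mapsto> F (u / n)\<close> the multipliers of \<open>theta1\<close>, so it is
  \<open>K * theta1 u\<close>; \<open>R\<close> is what remains of \<open>F\<close> once its factor
  vanishing at 0 is removed, and derivatives at 0 give \<open>K = R 0 / n\<close>.\<close>

lemma theta1_multiple:
  assumes \<tau>: "Im \<tau> > 0" and n: "n > 0" and hol: "R holomorphic_on UNIV" and R0: "R 0 \<noteq> 0"
    and F: "\<And>z. F z = theta1 z \<tau> * R z"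
    and F_pi: "\<And>z. F (z + of_real pi / of_nat n) = - F z"
    and F_pi_tau: "\<And>z. F (z + of_real pi * \<tau> / of_nat n)
                     = - exp (- (\<i> * of_real pi * \<tau>) - 2 * \<i> * (of_nat n * z)) * F z"
  shows "theta1 (of_nat n * z) \<tau> = of_nat n / R 0 * F z"
proof -
  have holF: "F holomorphic_on UNIV"
    unfolding F[abs_def] by (intro holomorphic_intros holomorphic_theta1[OF \<tau>] hol)
  obtain K where K: "\<And>u. F (u / of_nat n) = K * theta1 u \<tau>"
  proof (rule entire_eq_mult_theta1[OF \<tau>, of "\<lambda>u. F (u / of_nat n)"])
    show "(\<lambda>u. F (u / of_nat n)) holomorphic_on UNIV"
      by (intro holomorphic_intros holomorphic_on_compose_gen[OF _ holF, unfolded o_def]) (use n in auto)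
    show "F (0 / of_nat n) = 0"
      by (simp add: F theta1_def)
    show "F ((u + of_real pi) / of_nat n) = - F (u / of_nat n)" for u
      using F_pi[of "u / of_nat n"] by (simp add: add_divide_distrib)
    show "F ((u + of_real pi * \<tau>) / of_nat n) = - exp (- (\<i> * of_real pi * \<tau>) - 2 * \<i> * u) * F (u / of_nat n)" for u
      using F_pi_tau[of "u / of_nat n"] n by (simp add: add_divide_distrib)
  qed blast
  have eq: "theta1 z \<tau> * R z = K * theta1 (of_nat n * z) \<tau>" for z
    using K[of "of_nat n * z"] n by (simp add: F)
  obtain t where t: "((\<lambda>z. theta1 z \<tau>) has_field_derivative t) (at 0)" "t \<noteq> 0"
    using theta1_deriv_0[OF \<tau>] .
  obtain R' where R': "(R has_field_derivative R') (at 0)"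
    using hol by (metis UNIV_I open_UNIV holomorphic_on_open)
  have "((\<lambda>z. theta1 z \<tau> * R z) has_field_derivative t * R 0 + R' * theta1 0 \<tau>) (at 0)"
    by (rule DERIV_mult[OF t(1) R'])
  moreover have "((\<lambda>z. K * theta1 (of_nat n * z) \<tau>) has_field_derivative K * (t * of_nat n)) (at 0)"
  proof (rule DERIV_cmult)
    have "((\<lambda>z. theta1 z \<tau>) has_field_derivative t) (at (of_nat n * 0))"
      using t(1) by simp
    then show "((\<lambda>z. theta1 (of_nat n * z) \<tau>) has_field_derivative t * of_nat n) (at 0)"
      by (rule DERIV_chain2) (rule derivative_eq_intros refl | simp)+
  qed
  \<comment> \<open>The term with \<open>R'\<close> drops out since
    \<open>theta1 0 \<tau> = 0\<close>, and \<open>t\<close> cancels because it is nonzero.\<close>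
  ultimately have "t * R 0 + R' * theta1 0 \<tau> = K * (t * of_nat n)"
    unfolding eq by (rule DERIV_unique)
  then have "R 0 = K * of_nat n"
    using t(2) by (simp add: theta1_def)
  with R0 show ?thesis
    using eq[of z] by (auto simp: F)
qed

subsection \<open>Products over torsion points\<close>

text \<open>Shifting the index replaces the first factor by the one just past the end. The relation
  between these two is stated by multiplication, since \<open>f a\<close> may be 0.\<close>

lemma prod_int_shift:
  fixes f :: "int \<Rightarrow> complex"
  assumes "a \<le> b" "f (b + 1) = c * f a"
  shows "(\<Prod>k = a..b. f (k + 1)) = c * (\<Prod>k = a..b. f k)"
proof -
  have "(\<Prod>k = a..b. f (k + 1)) = (\<Prod>k = a + 1..b + 1. f k)"
    by (rule prod.reindex_bij_witness[of _ "\<lambda>k. k - 1" "\<lambda>k. k + 1"]) auto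
  also have "{a + 1..b + 1} = insert (b + 1) {a + 1..b}"
    using assms(1) by auto
  also have "(\<Prod>k\<in>insert (b + 1) {a + 1..b}. f k) = c * (f a * (\<Prod>k = a + 1..b. f k))"
    using assms(2) by simp
  also have "f a * (\<Prod>k = a + 1..b. f k) = prod f (insert a {a + 1..b})"
    by simp
  also have "insert a {a + 1..b} = {a..b}"
    using assms(1) by auto
  finally show ?thesis .
qed

lemma sum_int_interval:
  assumes "int n = b - a + 1"
  shows "2 * (\<Sum>k = a..b. of_int k :: complex) = of_nat n * (of_int a + of_int b)"
  using assms
proof (induction n arbitrary: b)
  case 0
  then show ?case by simp
next
  case (Suc n)
  then have "{a..b} = insert b {a..b - 1}" by auto
  then have "2 * (\<Sum>k = a..b. of_int k :: complex) = 2 * of_int b + 2 * (\<Sum>k = a..b - 1. of_int k)"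
    by simp
  also have "2 * (\<Sum>k = a..b - 1. of_int k :: complex) = of_nat n * (of_int a + of_int (b - 1))"
    using Suc.prems by (intro Suc.IH) simp
  moreover have "of_int b = (of_int a + of_nat n :: complex)"
    using arg_cong[OF Suc.prems, of "of_int :: int \<Rightarrow> complex"] by (simp add: algebra_simps)
  then have "2 * of_int b + of_nat n * (of_int a + of_int (b - 1)) = of_nat (Suc n) * (of_int a + of_int b :: complex)"
    by (simp add: algebra_simps)
  ultimately show ?case by simp
qed

text \<open>General bounds cover both parities: \<open>- l..l\<close> for
  \<open>n = 2 * l + 1\<close> and \<open>- (l - 1)..l\<close> for \<open>n = 2 * l\<close>.\<close>

definition theta1_grid :: "complex \<Rightarrow> nat \<Rightarrow> int \<Rightarrow> int \<Rightarrow> complex \<Rightarrow> complex" where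
  "theta1_grid \<tau> n a b z = (\<Prod>k = a..b. \<Prod>j = a..b.
     theta1 (z + of_int k * of_real pi / of_nat n + of_int j * of_real pi * \<tau> / of_nat n) \<tau>)"

context
  fixes \<tau> :: complex and n :: nat and a b :: int
  assumes \<tau>: "Im \<tau> > 0" and n: "n > 0" and ab: "int n = b - a + 1"
begin

lemma of_nat_grid: "(of_nat n :: complex) = of_int b - of_int a + 1"
  using arg_cong[OF ab, of "of_int :: int \<Rightarrow> complex"] by simp

lemma card_grid: "card {a..b} = n"
  using ab by simp

text \<open>The shift moves \<open>k\<close> to \<open>k + 1\<close>. The overflow at
  \<open>b + 1\<close> is the line \<open>k = a\<close> moved by a full period, which costs a factor
  -1 for each of the \<open>n\<close> values of \<open>j\<close>.\<close>

lemma theta1_grid_add_pi: "theta1_grid \<tau> n a b (z + of_real pi / of_nat n) = (-1) ^ n * theta1_grid \<tau> n a b z"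
proof -
  define g where "g k = (\<Prod>j = a..b.
     theta1 (z + of_int k * of_real pi / of_nat n + of_int j * of_real pi * \<tau> / of_nat n) \<tau>)" for k :: int
  have "g (b + 1) = (\<Prod>j = a..b. - theta1 (z + of_int a * of_real pi / of_nat n + of_int j * of_real pi * \<tau> / of_nat n) \<tau>)"
    unfolding g_def
  proof (rule prod.cong[OF refl])
    fix j
    have "z + of_int (b + 1) * of_real pi / of_nat n + of_int j * of_real pi * \<tau> / of_nat n
       = (z + of_int a * of_real pi / of_nat n + of_int j * of_real pi * \<tau> / of_nat n) + of_real pi"
    proof -
      have "of_int (b + 1) = (of_int a + of_nat n :: complex)" by (simp add: of_nat_grid)
      then show ?thesis using n by (simp add: distrib_right add_divide_distrib)
    qed
    then show "theta1 (z + of_int (b + 1) * of_real pi / of_nat n + of_int j * of_real pi * \<tau> / of_nat n) \<tau>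
       = - theta1 (z + of_int a * of_real pi / of_nat n + of_int j * of_real pi * \<tau> / of_nat n) \<tau>"
      by (simp only: theta1_add_pi[OF \<tau>])
  qed
  also have "\<dots> = (-1) ^ n * g a"
    by (simp add: g_def prod_uminus card_grid del: card_atLeastAtMost_int)
  finally have "(\<Prod>k = a..b. g (k + 1)) = (-1) ^ n * (\<Prod>k = a..b. g k)"
    using ab n by (intro prod_int_shift) auto
  moreover have "theta1_grid \<tau> n a b (z + of_real pi / of_nat n) = (\<Prod>k = a..b. g (k + 1))"
    unfolding theta1_grid_def g_def by (simp add: distrib_right add_divide_distrib add_ac)
  ultimately show ?thesis
    by (simp add: theta1_grid_def g_def)
qed

text \<open>For each \<open>k\<close> the index \<open>j\<close> wraps around from
  \<open>b + 1\<close> to \<open>a\<close>, at the price of one multiplier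
  \<open>- exp (c k)\<close>. Summing the exponents is an arithmetic series in \<open>k\<close>, and
  \<open>n + 2 * a = a + b + 1\<close> gives the coefficient of \<open>\<pi>\<tau>\<close>.\<close>

lemma theta1_grid_add_pi_tau:
  "theta1_grid \<tau> n a b (z + of_real pi * \<tau> / of_nat n)
     = (-1) ^ n * exp (- (\<i> * of_real pi * of_int (a + b)))
         * exp (- (\<i> * of_real pi * \<tau> * of_int (a + b + 1)) - 2 * \<i> * (of_nat n * z)) * theta1_grid \<tau> n a b z"
proof -
  define c where "c k = - (\<i> * of_real pi * \<tau>)
     - 2 * \<i> * (z + of_int k * of_real pi / of_nat n + of_int a * of_real pi * \<tau> / of_nat n)" for k :: int
  define g where "g k j =
     theta1 (z + of_int k * of_real pi / of_nat n + of_int j * of_real pi * \<tau> / of_nat n) \<tau>" for k j :: int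
  have "theta1_grid \<tau> n a b (z + of_real pi * \<tau> / of_nat n) = (\<Prod>k = a..b. \<Prod>j = a..b. g k (j + 1))"
    unfolding theta1_grid_def g_def by (simp add: distrib_right add_divide_distrib add_ac)
  also have "\<dots> = (\<Prod>k = a..b. - exp (c k) * (\<Prod>j = a..b. g k j))"
  proof (rule prod.cong[OF refl], rule prod_int_shift)
    show "a \<le> b" using ab n by simp
    fix k
    have "of_int (b + 1) = (of_int a + of_nat n :: complex)" by (simp add: of_nat_grid)
    then have "z + of_int k * of_real pi / of_nat n + of_int (b + 1) * of_real pi * \<tau> / of_nat n
       = (z + of_int k * of_real pi / of_nat n + of_int a * of_real pi * \<tau> / of_nat n) + of_real pi * \<tau>"
      using n by (simp add: distrib_right add_divide_distrib)
    then show "g k (b + 1) = - exp (c k) * g k a"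
      unfolding g_def c_def by (simp only: theta1_add_pi_tau[OF \<tau>])
  qed
  also have "\<dots> = (-1) ^ n * exp (\<Sum>k = a..b. c k) * theta1_grid \<tau> n a b z"
    by (simp add: prod.distrib prod_uminus exp_sum card_grid theta1_grid_def g_def
        del: card_atLeastAtMost_int)
  also have "(\<Sum>k = a..b. c k) = - (\<i> * of_real pi * of_int (a + b))
      + (- (\<i> * of_real pi * \<tau> * of_int (a + b + 1)) - 2 * \<i> * (of_nat n * z))"
  proof -
    have "(\<Sum>k = a..b. c k) = (\<Sum>k = a..b. (- (\<i> * of_real pi * \<tau>) - 2 * \<i> * (z + of_int a * of_real pi * \<tau> / of_nat n))
        - \<i> * of_real pi / of_nat n * (2 * of_int k))"
      by (intro sum.cong) (simp_all add: c_def algebra_simps)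
    also have "\<dots> = of_nat n * (- (\<i> * of_real pi * \<tau>) - 2 * \<i> * (z + of_int a * of_real pi * \<tau> / of_nat n))
        - \<i> * of_real pi / of_nat n * (2 * (\<Sum>k = a..b. of_int k))"
      by (simp only: sum_subtractf sum_constant card_grid sum_distrib_left right_diff_distrib)
    also have "\<dots> = - (\<i> * of_real pi * \<tau> * (of_nat n + 2 * of_int a)) - 2 * \<i> * (of_nat n * z) - \<i> * of_real pi * of_int (a + b)"
      unfolding sum_int_interval[OF ab] using n by (simp add: field_simps)
    also have "of_nat n + 2 * of_int a = (of_int (a + b + 1) :: complex)"
      by (simp add: of_nat_grid)
    finally show ?thesis by simp
  qed
  finally show ?thesis by (simp only: exp_add mult.assoc)
qed

end

section \<open>The half period, and non-vanishing at the points of the grid\<close>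

text \<open>Two half-period shifts make one full period of \<open>theta4\<close>. In the even case
  this converts the line \<open>j = l\<close> of the grid into \<open>theta4\<close>
  factors.\<close>

lemma theta1_add_half_pi_tau:
  assumes "Im \<tau> > 0"
  shows "theta1 (z + of_real pi * \<tau> / 2) \<tau> = \<i> * exp (- (\<i> * of_real pi * \<tau> / 4) - \<i> * z) * theta4 z \<tau>"
proof -
  have "theta1 (z + of_real pi * \<tau> / 2) \<tau>
     = - \<i> * exp (\<i> * of_real pi * \<tau> / 4 + \<i> * (z + of_real pi * \<tau> / 2)) * theta4 (z + of_real pi * \<tau>) \<tau>"
  proof -
    have "z + of_real pi * \<tau> / 2 + of_real pi * \<tau> / 2 = z + of_real pi * \<tau>"
      by simp
    then show ?thesis
      by (simp only: theta1_eq_theta4[OF assms, of "z + of_real pi * \<tau> / 2"])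
  qed
  also have "\<dots> = \<i> * (exp (\<i> * of_real pi * \<tau> / 4 + \<i> * (z + of_real pi * \<tau> / 2))
      * exp (- (\<i> * of_real pi * \<tau>) - 2 * \<i> * z)) * theta4 z \<tau>"
    unfolding theta4_add_pi_tau[OF assms] by simp
  also have "exp (\<i> * of_real pi * \<tau> / 4 + \<i> * (z + of_real pi * \<tau> / 2)) * exp (- (\<i> * of_real pi * \<tau>) - 2 * \<i> * z)
      = exp (- (\<i> * of_real pi * \<tau> / 4) - \<i> * z)"
    unfolding exp_add[symmetric] by (rule arg_cong[of _ _ exp]) (simp add: algebra_simps)
  finally show ?thesis .
qed

text \<open>A zero would be a lattice point. As \<open>\<tau>\<close> is not real, comparing
  coordinates makes \<open>k\<close> and \<open>j\<close> multiples of \<open>n\<close>, and their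
  size then forces both to be 0.\<close>

lemma theta1_torsion_nonzero:
  assumes "Im \<tau> > 0" "\<bar>k\<bar> < int n" "\<bar>j\<bar> < int n" "\<bar>j\<bar> + \<bar>k\<bar> \<noteq> 0"
  shows "theta1 (of_int k * of_real pi / of_nat n + of_int j * of_real pi * \<tau> / of_nat n) \<tau> \<noteq> 0"
proof
  assume "theta1 (of_int k * of_real pi / of_nat n + of_int j * of_real pi * \<tau> / of_nat n) \<tau> = 0"
  then obtain m m' :: int where eq: "of_int k * of_real pi / of_nat n + of_int j * of_real pi * \<tau> / of_nat n
      = of_int m * of_real pi + of_int m' * (of_real pi * \<tau>)"
    using theta1_eq_0D[OF assms(1)] by blast
  have n: "n > 0" using assms(2) by auto
  have "of_int k * of_real pi + of_int j * of_real pi * \<tau>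
      = of_nat n * (of_int k * of_real pi / of_nat n + of_int j * of_real pi * \<tau> / of_nat n)"
    using n by (simp add: field_simps)
  also have "\<dots> = of_nat n * (of_int m * of_real pi + of_int m' * (of_real pi * \<tau>))"
    unfolding eq ..
  finally have eq: "of_int k * of_real pi + of_int j * of_real pi * \<tau>
      = of_nat n * (of_int m * of_real pi + of_int m' * (of_real pi * \<tau>))" .
  have small: "i = 0" if "\<bar>i\<bar> < int n" "i = int n * m" for i m :: int
    using that zdvd_not_zless[of "\<bar>i\<bar>" "int n"] by (metis abs_0_eq dvd_abs_iff dvd_triv_left zero_less_abs_iff)
  \<comment> \<open>The imaginary part determines \<open>j\<close>; only after \<open>j\<close> and
    \<open>m'\<close> are known to be 0 does the real part determine \<open>k\<close>.\<close>
  have "real_of_int j * pi * Im \<tau> = real_of_int (int n * m') * pi * Im \<tau>"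
    using arg_cong[OF eq, of Im] by (simp add: algebra_simps)
  then have "j = int n * m'"
    using assms(1) by (simp only: mult_cancel_right of_int_eq_iff) auto
  with small assms(3) have j: "j = 0" by blast
  then have "m' = 0"
    using \<open>j = int n * m'\<close> n by simp
  with j have "real_of_int k * pi = real_of_int (int n * m) * pi"
    using arg_cong[OF eq, of Re] by simp
  then have "k = int n * m"
    by (simp only: mult_cancel_right of_int_eq_iff) auto
  with small assms(2) have "k = 0" by blast
  with j assms(4) show False by simp
qed

text \<open>A real zero would put \<open>z + \<pi>\<tau> / 2\<close> into the lattice, and imaginary
  parts would then make 1 an even integer.\<close>

lemma theta4_real_nonzero:
  assumes "Im \<tau> > 0" "z \<in> \<real>"
  shows "theta4 z \<tau> \<noteq> 0"
proof
  assume "theta4 z \<tau> = 0"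
  then have "theta1 (z + of_real pi * \<tau> / 2) \<tau> = 0"
    by (simp add: theta1_add_half_pi_tau[OF assms(1)])
  then obtain m n :: int where "z + of_real pi * \<tau> / 2 = of_int m * of_real pi + of_int n * (of_real pi * \<tau>)"
    using theta1_eq_0D[OF assms(1)] by blast
  from arg_cong[OF this, of Im] have "pi * Im \<tau> * 1 = pi * Im \<tau> * real_of_int (2 * n)"
    using assms(2) by (auto simp: complex_is_Real_iff)
  then have "real_of_int 1 = real_of_int (2 * n)"
    using assms(1) by (subst (asm) mult_left_cancel) auto
  then show False
    unfolding of_int_eq_iff by presburger
qed

lemma prod_grid_remove_origin:
  fixes f :: "int \<Rightarrow> int \<Rightarrow> complex"
  assumes "finite A" "finite B" "0 \<in> A" "0 \<in> B"
  shows "(\<Prod>k\<in>A. \<Prod>j\<in>B. f k j)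
    = f 0 0 * (\<Prod>(k, j)\<in>{(k, j). k \<in> A \<and> j \<in> B \<and> \<bar>j\<bar> + \<bar>k\<bar> \<noteq> 0}. f k j)"
proof -
  have "{(k, j). k \<in> A \<and> j \<in> B \<and> \<bar>j\<bar> + \<bar>k\<bar> \<noteq> 0} = A \<times> B - {(0, 0)}"
    by auto
  then show ?thesis
    using assms by (simp add: prod.cartesian_product prod.remove[of "A \<times> B" "(0, 0)"])
qed

lemma finite_grid_nonzero:
  "finite A \<Longrightarrow> finite B \<Longrightarrow> finite {(k :: int, j :: int). k \<in> A \<and> j \<in> B \<and> \<bar>j\<bar> + \<bar>k\<bar> \<noteq> 0}"
  by (rule finite_subset[of _ "A \<times> B"]) auto

section \<open>The multiplication formulas for odd and even factors\<close>

text \<open>The grid is symmetric, so \<open>a + b = 0\<close>, and \<open>n\<close> is odd: the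
  general grid multipliers are then exactly those required by
  \<open>theta1_multiple\<close>.\<close>

lemma theta1_odd_multiple:
  assumes \<tau>: "Im \<tau> > 0"
  shows "\<exists>C :: complex. C \<noteq> 0 \<and>
        inverse C = 1 / of_nat (2 * l + 1) *
          (\<Prod>(k, j) \<in> {(k, j). k \<in> {- int l..int l} \<and> j \<in> {- int l..int l} \<and> \<bar>j\<bar> + \<bar>k\<bar> \<noteq> 0}.
             theta1 (of_int k * of_real pi / of_nat (2 * l + 1)
                     + of_int j * of_real pi * \<tau> / of_nat (2 * l + 1)) \<tau>) \<and>
        (\<forall>z :: complex. theta1 (of_nat (2 * l + 1) * z) \<tau> =
           C * (\<Prod>k = - int l..int l. \<Prod>j = - int l..int l.
                  theta1 (z + of_int k * of_real pi / of_nat (2 * l + 1)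
                            + of_int j * of_real pi * \<tau> / of_nat (2 * l + 1)) \<tau>))"
proof -
  define n where "n = 2 * l + 1"
  define S where "S = {(k, j). k \<in> {- int l..int l} \<and> j \<in> {- int l..int l} \<and> \<bar>j\<bar> + \<bar>k\<bar> \<noteq> 0}"
  define R where "R z = (\<Prod>(k, j)\<in>S. theta1 (z + of_int k * of_real pi / of_nat n + of_int j * of_real pi * \<tau> / of_nat n) \<tau>)" for z
  define F where "F z = (\<Prod>k = - int l..int l. \<Prod>j = - int l..int l.
                  theta1 (z + of_int k * of_real pi / of_nat n + of_int j * of_real pi * \<tau> / of_nat n) \<tau>)" for z
  have n: "n > 0" "int n = int l - (- int l) + 1" by (simp_all add: n_def)
  have F_grid: "F z = theta1_grid \<tau> n (- int l) (int l) z" for z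
    unfolding F_def theta1_grid_def ..
  have finS: "finite S"
    unfolding S_def by (rule finite_grid_nonzero) auto
  have R0: "R 0 \<noteq> 0"
  proof -
    have "theta1 (of_int k * of_real pi / of_nat n + of_int j * of_real pi * \<tau> / of_nat n) \<tau> \<noteq> 0" if "(k, j) \<in> S" for k j
      using that by (intro theta1_torsion_nonzero[OF \<tau>]) (auto simp: S_def n_def)
    then show ?thesis
      using finS by (auto simp: R_def)
  qed
  have mult: "theta1 (of_nat n * z) \<tau> = of_nat n / R 0 * F z" for z
  proof (rule theta1_multiple[OF \<tau> n(1), of R F])
    show "R 0 \<noteq> 0" by (rule R0)
    show "R holomorphic_on UNIV"
      unfolding R_def[abs_def] case_prod_unfold
      by (intro holomorphic_intros holomorphic_on_compose_gen[OF _ holomorphic_theta1[OF \<tau>], unfolded o_def]) (use n in auto)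
    show "F z = theta1 z \<tau> * R z" for z
      unfolding F_def R_def S_def by (subst prod_grid_remove_origin) auto
    show "F (z + of_real pi / of_nat n) = - F z" for z
      unfolding F_grid theta1_grid_add_pi[OF \<tau> n] by (simp add: n_def)
    show "F (z + of_real pi * \<tau> / of_nat n) = - exp (- (\<i> * of_real pi * \<tau>) - 2 * \<i> * (of_nat n * z)) * F z" for z
      unfolding F_grid theta1_grid_add_pi_tau[OF \<tau> n] by (simp add: n_def del: of_nat_add of_nat_mult of_nat_Suc)
  qed
  show ?thesis
    unfolding n_def[symmetric] S_def[symmetric]
  proof (intro exI[of _ "of_nat n / R 0"] conjI allI)
    show "of_nat n / R 0 \<noteq> 0" using n R0 by simp
    show "inverse (of_nat n / R 0) = 1 / of_nat n * (\<Prod>(k, j)\<in>S.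
        theta1 (of_int k * of_real pi / of_nat n + of_int j * of_real pi * \<tau> / of_nat n) \<tau>)"
      by (simp add: R_def)
  qed (use mult in \<open>simp add: F_def\<close>)
qed

text \<open>Here \<open>a + b = 1\<close> and \<open>n\<close> is even, so the grid alone has the
  wrong multipliers. Rewriting its line \<open>j = l\<close> through \<open>theta4\<close> removes a
  factor \<open>exp (- \<i> * n * z)\<close>, which corrects both of them.\<close>

lemma theta1_even_multiple:
  assumes \<tau>: "Im \<tau> > 0" and l: "l \<ge> 1"
  shows "\<exists>C' :: complex. C' \<noteq> 0 \<and>
        inverse C' = 1 / of_nat (2 * l) *
          (\<Prod>m = - (int l - 1)..int l. theta4 (of_int m * of_real pi / of_nat (2 * l)) \<tau>) *
          (\<Prod>(k, j) \<in> {(k, j). k \<in> {- (int l - 1)..int l} \<and> j \<in> {- (int l - 1)..int l - 1}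
                               \<and> \<bar>j\<bar> + \<bar>k\<bar> \<noteq> 0}.
             theta1 (of_int k * of_real pi / of_nat (2 * l)
                     + of_int j * of_real pi * \<tau> / of_nat (2 * l)) \<tau>) \<and>
        (\<forall>z :: complex. theta1 (of_nat (2 * l) * z) \<tau> =
           C' * (\<Prod>m = - (int l - 1)..int l.
                   theta4 (z + of_int m * of_real pi / of_nat (2 * l)) \<tau>) *
           (\<Prod>k = - (int l - 1)..int l. \<Prod>j = - (int l - 1)..int l - 1.
              theta1 (z + of_int k * of_real pi / of_nat (2 * l)
                        + of_int j * of_real pi * \<tau> / of_nat (2 * l)) \<tau>))"
proof -
  define n where "n = 2 * l"
  define a where "a = - (int l - 1)"
  define S where "S = {(k, j). k \<in> {a..int l} \<and> j \<in> {a..int l - 1} \<and> \<bar>j\<bar> + \<bar>k\<bar> \<noteq> 0}"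
  define R1 where "R1 z = (\<Prod>(k, j)\<in>S. theta1 (z + of_int k * of_real pi / of_nat n + of_int j * of_real pi * \<tau> / of_nat n) \<tau>)" for z
  define T where "T z = (\<Prod>m = a..int l. theta4 (z + of_int m * of_real pi / of_nat n) \<tau>)" for z
  define H where "H z = (\<Prod>k = a..int l. \<Prod>j = a..int l - 1.
                  theta1 (z + of_int k * of_real pi / of_nat n + of_int j * of_real pi * \<tau> / of_nat n) \<tau>)" for z
  \<comment> \<open>The part independent of \<open>z\<close> of the exponential factors produced by
    the line \<open>j = l\<close>.\<close>
  define U where "U = (\<Prod>k = a..int l. \<i> * exp (- (\<i> * of_real pi * \<tau> / 4) - \<i> * (of_int k * of_real pi / of_nat n)))"
  have n: "n > 0" "int n = int l - a + 1" using l by (simp_all add: n_def a_def)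
  have U: "U \<noteq> 0" by (simp add: U_def)
  have grid: "theta1_grid \<tau> n a (int l) z = U * exp (- (\<i> * (of_nat n * z))) * (T z * H z)" for z
  proof -
    have "{a..int l} = insert (int l) {a..int l - 1}" using l by (auto simp: a_def)
    then have "theta1_grid \<tau> n a (int l) z
        = (\<Prod>k = a..int l. theta1 (z + of_int k * of_real pi / of_nat n + of_int (int l) * of_real pi * \<tau> / of_nat n) \<tau>) * H z"
      unfolding theta1_grid_def H_def prod.distrib[symmetric] by (intro prod.cong) auto
    also have "(\<Prod>k = a..int l. theta1 (z + of_int k * of_real pi / of_nat n + of_int (int l) * of_real pi * \<tau> / of_nat n) \<tau>)
       = (\<Prod>k = a..int l. (\<i> * exp (- (\<i> * of_real pi * \<tau> / 4) - \<i> * (of_int k * of_real pi / of_nat n))) * exp (- (\<i> * z))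
            * theta4 (z + of_int k * of_real pi / of_nat n) \<tau>)"
    proof (rule prod.cong[OF refl])
      fix k
      have "of_int (int l) * of_real pi * \<tau> / of_nat n = of_real pi * \<tau> / 2"
        using l by (simp add: n_def)
      moreover have "exp (- (\<i> * of_real pi * \<tau> / 4) - \<i> * (z + of_int k * of_real pi / of_nat n))
          = exp (- (\<i> * of_real pi * \<tau> / 4) - \<i> * (of_int k * of_real pi / of_nat n)) * exp (- (\<i> * z))"
        unfolding exp_add[symmetric] by (rule arg_cong[of _ _ exp]) (simp add: algebra_simps)
      ultimately show "theta1 (z + of_int k * of_real pi / of_nat n + of_int (int l) * of_real pi * \<tau> / of_nat n) \<tau>
        = (\<i> * exp (- (\<i> * of_real pi * \<tau> / 4) - \<i> * (of_int k * of_real pi / of_nat n))) * exp (- (\<i> * z))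
            * theta4 (z + of_int k * of_real pi / of_nat n) \<tau>"
        by (simp only: theta1_add_half_pi_tau[OF \<tau>] mult.assoc)
    qed
    also have "\<dots> = U * exp (- (\<i> * z)) ^ n * T z"
      using card_grid[OF \<tau> n] by (simp only: prod.distrib prod_constant U_def T_def)
    also have "exp (- (\<i> * z)) ^ n = exp (- (\<i> * (of_nat n * z)))"
      by (simp add: exp_of_nat_mult[symmetric] mult_ac)
    finally show ?thesis by (simp add: mult_ac)
  qed
  \<comment> \<open>Solved for the product of interest, so that its multipliers follow from those of
    the grid.\<close>
  have TH: "T z * H z = exp (\<i> * (of_nat n * z)) / U * theta1_grid \<tau> n a (int l) z" for z
    using U by (simp add: grid exp_minus)
  have T0: "T 0 \<noteq> 0"
    unfolding T_def by (auto intro!: theta4_real_nonzero[OF \<tau>] Reals_divide Reals_mult)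
  have finS: "finite S"
    unfolding S_def by (rule finite_grid_nonzero) auto
  have R1_0: "R1 0 \<noteq> 0"
  proof -
    have "theta1 (of_int k * of_real pi / of_nat n + of_int j * of_real pi * \<tau> / of_nat n) \<tau> \<noteq> 0" if "(k, j) \<in> S" for k j
      using that by (intro theta1_torsion_nonzero[OF \<tau>]) (auto simp: S_def n_def a_def)
    then show ?thesis
      using finS by (auto simp: R1_def)
  qed
  have mult: "theta1 (of_nat n * z) \<tau> = of_nat n / (T 0 * R1 0) * (T z * H z)" for z
  proof (rule theta1_multiple[OF \<tau> n(1), of "\<lambda>z. T z * R1 z" "\<lambda>z. T z * H z"])
    show "(\<lambda>z. T z * R1 z) holomorphic_on UNIV"
      unfolding R1_def[abs_def] T_def[abs_def] case_prod_unfold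
      by (intro holomorphic_intros holomorphic_on_compose_gen[OF _ holomorphic_theta1[OF \<tau>], unfolded o_def]
            holomorphic_on_compose_gen[OF _ holomorphic_theta4[OF \<tau>], unfolded o_def]) (use n in auto)
    show "T 0 * R1 0 \<noteq> 0" using T0 R1_0 by simp
    show "T z * H z = theta1 z \<tau> * (T z * R1 z)" for z
    proof -
      have "H z = theta1 z \<tau> * R1 z"
        unfolding H_def R1_def S_def using l by (subst prod_grid_remove_origin) (auto simp: a_def)
      then show ?thesis by simp
    qed
    show "T (z + of_real pi / of_nat n) * H (z + of_real pi / of_nat n) = - (T z * H z)" for z
    proof -
      \<comment> \<open>The grid contributes \<open>(-1) ^ n = 1\<close>; the required sign comes
        from this exponential.\<close>
      have "exp (\<i> * (of_nat n * (z + of_real pi / of_nat n))) = - exp (\<i> * (of_nat n * z))"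
        using n by (simp add: distrib_left exp_add)
      then show ?thesis
        unfolding TH theta1_grid_add_pi[OF \<tau> n] by (simp add: n_def)
    qed
    show "T (z + of_real pi * \<tau> / of_nat n) * H (z + of_real pi * \<tau> / of_nat n)
        = - exp (- (\<i> * of_real pi * \<tau>) - 2 * \<i> * (of_nat n * z)) * (T z * H z)" for z
    proof -
      have ab: "a + int l = 1" by (simp add: a_def)
      \<comment> \<open>The grid exponent carries \<open>2 * \<pi>\<tau>\<close> because
        \<open>a + b + 1 = 2\<close>; the exponential correction takes one of the two away.\<close>
      have "exp (\<i> * (of_nat n * (z + of_real pi * \<tau> / of_nat n)))
            * exp (- (\<i> * of_real pi * \<tau> * of_int (1 + 1)) - 2 * \<i> * (of_nat n * z))
          = exp (- (\<i> * of_real pi * \<tau>) - 2 * \<i> * (of_nat n * z)) * exp (\<i> * (of_nat n * z))"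
        unfolding exp_add[symmetric] using n by (intro arg_cong[of _ _ exp]) (simp add: field_simps)
      moreover have "exp (- (\<i> * of_real pi * of_int 1)) = -1" "(-1 :: complex) ^ n = 1"
        by (simp_all add: exp_minus n_def)
      ultimately show ?thesis
        unfolding TH theta1_grid_add_pi_tau[OF \<tau> n] ab by simp
    qed
  qed
  show ?thesis
    unfolding n_def[symmetric] a_def[symmetric] S_def[symmetric]
  proof (intro exI[of _ "of_nat n / (T 0 * R1 0)"] conjI allI)
    show "of_nat n / (T 0 * R1 0) \<noteq> 0" using n T0 R1_0 by simp
    show "inverse (of_nat n / (T 0 * R1 0)) = 1 / of_nat n * (\<Prod>m = a..int l. theta4 (of_int m * of_real pi / of_nat n) \<tau>) * (\<Prod>(k, j)\<in>S.
        theta1 (of_int k * of_real pi / of_nat n + of_int j * of_real pi * \<tau> / of_nat n) \<tau>)"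
      by (simp add: R1_def T_def)
  qed (use mult in \<open>simp add: T_def H_def mult.assoc\<close>)
qed

theorem theorem3:
  fixes \<tau> :: complex and l :: nat
  assumes "Im \<tau> > 0" and "l \<ge> 1"
  shows
    "(\<exists>C :: complex. C \<noteq> 0 \<and>
        inverse C = 1 / of_nat (2 * l + 1) *
          (\<Prod>(k, j) \<in> {(k, j). k \<in> {- int l..int l} \<and> j \<in> {- int l..int l} \<and> \<bar>j\<bar> + \<bar>k\<bar> \<noteq> 0}.
             theta1 (of_int k * of_real pi / of_nat (2 * l + 1)
                     + of_int j * of_real pi * \<tau> / of_nat (2 * l + 1)) \<tau>) \<and>
        (\<forall>z :: complex. theta1 (of_nat (2 * l + 1) * z) \<tau> =
           C * (\<Prod>k = - int l..int l. \<Prod>j = - int l..int l.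
                  theta1 (z + of_int k * of_real pi / of_nat (2 * l + 1)
                            + of_int j * of_real pi * \<tau> / of_nat (2 * l + 1)) \<tau>)))
     \<and>
     (\<exists>C' :: complex. C' \<noteq> 0 \<and>
        inverse C' = 1 / of_nat (2 * l) *
          (\<Prod>m = - (int l - 1)..int l. theta4 (of_int m * of_real pi / of_nat (2 * l)) \<tau>) *
          (\<Prod>(k, j) \<in> {(k, j). k \<in> {- (int l - 1)..int l} \<and> j \<in> {- (int l - 1)..int l - 1}
                               \<and> \<bar>j\<bar> + \<bar>k\<bar> \<noteq> 0}.
             theta1 (of_int k * of_real pi / of_nat (2 * l)
                     + of_int j * of_real pi * \<tau> / of_nat (2 * l)) \<tau>) \<and>
        (\<forall>z :: complex. theta1 (of_nat (2 * l) * z) \<tau> =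
           C' * (\<Prod>m = - (int l - 1)..int l.
                   theta4 (z + of_int m * of_real pi / of_nat (2 * l)) \<tau>) *
           (\<Prod>k = - (int l - 1)..int l. \<Prod>j = - (int l - 1)..int l - 1.
              theta1 (z + of_int k * of_real pi / of_nat (2 * l)
                        + of_int j * of_real pi * \<tau> / of_nat (2 * l)) \<tau>)))"
  by (intro conjI theta1_odd_multiple[OF assms(1)] theta1_even_multiple[OF assms])

end
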